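(* For each integer $k\ge 3$ there exists an $\mathbb{N}$-valued $k$-step stationary and $\psi$-mixing Markov chain $\{A_n\}_{n=1}^{\infty}$ with $\dim_H(\nu)\ge 1-2^{3-k}$, where $\nu$ is the distribution of $[A_1,A_2,\ldots]$.
   Context: $\mathbb{N}=\{1,2,\ldots\}$ and $X=(0,1)\setminus\mathbb{Q}$. For $a_1,a_2,\ldots\in\mathbb{N}$, $[a_1,a_2,\ldots]$ denotes the unique $x\in X$ whose (regular) continued fraction expansion is $x=\frac{1}{a_1+\frac{1}{a_2+\frac{1}{a_3+\cdots}}}$. A sequence of discrete random variables $\{A_n\}_{n\ge1}$ is a $k$-step Markov chain if for every $n\ge k$ the conditional distribution of $A_{n+1}$ given $A_1,\ldots,A_n$ equals its conditional distribution given $A_{n-k+1},\ldots,A_n$ only. For random variables $\{A_i\}_{i\in I}$, $\sigma\{A_i\}_{i\in I}$ is the smallest $\sigma$-algebra making all $A_i$ measurable. A sequence $\{A_n\}_{n=1}^\infty$ is $\psi$-mixing if there exists a real valued non-increasing function $g$ on the integers $n\ge1$ with $\lim_n g(n)=0$ such that for all $n\ge 1$, $m\ge1$, $E\in\sigma\{A_1,\ldots,A_m\}$ and $F\in\sigma\{A_{m+n},A_{m+n+1},\ldots\}$, $|\mathbb{P}(E\cap F)-\mathbb{P}(E)\mathbb{P}(F)|\le g(n)\mathbb{P}(E)\mathbb{P}(F)$. For $E\subset X$, $\dim_H(E)$ is its Hausdorff dimension. For a Borel probability measure $\nu$ on $X$, $\dim_H(\nu)=\inf\{\dim_H(E): E\subset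 X \text{ Borel},\ \nu(E)=1\}$. *)

theory Defs
  imports "HOL-Probability.Probability"
begin

section \<open>Hausdorff dimension\<close>

text \<open>Covers consist of bounded sets because \<^const>\<open>diameter\<close> is meaningful only for those.
  The exponent is positive in every use below, so the convention \<open>0 powr 0 = 0\<close> plays no role.\<close>

definition hausdorff_pre_measure :: "real \<Rightarrow> real \<Rightarrow> 'a::metric_space set \<Rightarrow> ennreal" where
  "hausdorff_pre_measure s \<delta> E =
     (INF U \<in> {U :: nat \<Rightarrow> 'a set. E \<subseteq> (\<Union>i. U i) \<and> (\<forall>i. bounded (U i) \<and> diameter (U i) \<le> \<delta>)}.
        \<Sum>i. ennreal (diameter (U i) powr s))"

definition hausdorff_measure :: "real \<Rightarrow> 'a::metric_space set \<Rightarrow> ennreal" where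
  "hausdorff_measure s E = (SUP \<delta>\<in>{0<..}. hausdorff_pre_measure s \<delta> E)"

definition hausdorff_dim :: "'a::metric_space set \<Rightarrow> ereal" where
  "hausdorff_dim E = (INF s \<in> {s. 0 < s \<and> hausdorff_measure s E = 0}. ereal s)"

definition unit_irrationals :: "real set" where
  "unit_irrationals = {0<..<1} - \<rat>"

definition measure_dim :: "real measure \<Rightarrow> ereal" where
  "measure_dim \<nu> =
     (INF E \<in> {E. E \<subseteq> unit_irrationals \<and> E \<in> sets borel \<and> emeasure \<nu> E = 1}. hausdorff_dim E)"


section \<open>Continued fractions\<close>

text \<open>All sequences in this and the next section are indexed from \<open>1\<close>; their value at index \<open>0\<close>
  is irrelevant.\<close>

primrec cf_convergent :: "nat \<Rightarrow> (nat \<Rightarrow> nat) \<Rightarrow> real" where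
  "cf_convergent 0 a = 0"
| "cf_convergent (Suc n) a = 1 / (real (a 1) + cf_convergent n (\<lambda>i. a (Suc i)))"

definition cf_value :: "(nat \<Rightarrow> nat) \<Rightarrow> real" where
  "cf_value a = (THE x. x \<in> unit_irrationals \<and> (\<lambda>n. cf_convergent n a) \<longlonglongrightarrow> x)"


section \<open>Discrete processes\<close>

definition positive_nat_process :: "'w measure \<Rightarrow> (nat \<Rightarrow> 'w \<Rightarrow> nat) \<Rightarrow> bool" where
  "positive_nat_process M A \<longleftrightarrow>
     (\<forall>n\<ge>1. A n \<in> measurable M (count_space UNIV) \<and> (\<forall>\<omega>\<in>space M. A n \<omega> \<ge> 1))"

text \<open>Conditional distributions are compared on all pasts of positive probability, where the
  elementary conditional probabilities are meaningful.\<close>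

definition markov_chain_step :: "'w measure \<Rightarrow> nat \<Rightarrow> (nat \<Rightarrow> 'w \<Rightarrow> nat) \<Rightarrow> bool" where
  "markov_chain_step M k A \<longleftrightarrow>
     (\<forall>n\<ge>k. \<forall>a :: nat \<Rightarrow> nat. \<forall>b.
        \<P>(\<omega> in M. \<forall>i\<in>{1..n}. A i \<omega> = a i) > 0 \<longrightarrow>
        \<P>(\<omega> in M. A (n + 1) \<omega> = b \<bar> \<forall>i\<in>{1..n}. A i \<omega> = a i) =
        \<P>(\<omega> in M. A (n + 1) \<omega> = b \<bar> \<forall>i\<in>{n - k + 1..n}. A i \<omega> = a i))"

definition stationary_process :: "'w measure \<Rightarrow> (nat \<Rightarrow> 'w \<Rightarrow> nat) \<Rightarrow> bool" where
  "stationary_process M A \<longleftrightarrow>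
     (\<forall>h. distr M (\<Pi>\<^sub>M i\<in>UNIV. count_space UNIV) (\<lambda>\<omega> i. A (Suc i + h) \<omega>) =
          distr M (\<Pi>\<^sub>M i\<in>UNIV. count_space UNIV) (\<lambda>\<omega> i. A (Suc i) \<omega>))"

definition generated_sigma :: "'w measure \<Rightarrow> (nat \<Rightarrow> 'w \<Rightarrow> nat) \<Rightarrow> nat set \<Rightarrow> 'w set set" where
  "generated_sigma M A I = sigma_sets (space M) {A i -` B \<inter> space M | i B. i \<in> I}"

definition psi_mixing :: "'w measure \<Rightarrow> (nat \<Rightarrow> 'w \<Rightarrow> nat) \<Rightarrow> bool" where
  "psi_mixing M A \<longleftrightarrow>
     (\<exists>g :: nat \<Rightarrow> real. antimono_on {1..} g \<and> g \<longlonglongrightarrow> 0 \<and>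
        (\<forall>n\<ge>1. \<forall>m\<ge>1. \<forall>E\<in>generated_sigma M A {1..m}. \<forall>F\<in>generated_sigma M A {m + n..}.
           \<bar>measure M (E \<inter> F) - measure M E * measure M F\<bar> \<le> g n * measure M E * measure M F))"

definition cf_distribution :: "'w measure \<Rightarrow> (nat \<Rightarrow> 'w \<Rightarrow> nat) \<Rightarrow> real measure" where
  "cf_distribution M A =
     distr M (restrict_space borel unit_irrationals) (\<lambda>\<omega>. cf_value (\<lambda>n. A n \<omega>))"

end

theory Submission
  imports Defs
begin

text \<open>
  The digits form the Markov chain of memory \<open>k\<close> that has the same marginals of length \<open>k + 1\<close> as the
  digits under the Gauss measure \<open>dx / ((1 + x) ln 2)\<close>. As that measure is invariant under the Gauss
  map, the chain is stationary from the outset.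

  \<open>\<psi>\<close>-mixing. The conditional probability of a digit \<open>a\<close> after any past is comparable to
  \<open>1 / (a (a + 1))\<close>, with absolute constants. Hence the laws of the next \<open>k\<close> digits after two different
  pasts dominate each other up to a constant factor. Such a block is the whole memory of the chain, so
  Doeblin's contraction argument (\<open>doeblin_contraction\<close>, \<open>oscillation_bound\<close>) makes the influence of
  the past on an event decay geometrically, relative to the probability of the event.

  Dimension. No entropy or ergodic theorem is involved, because the comparison with Lebesgue measure
  holds for every cylinder. Given \<open>k\<close> recent digits, the point lies in a known interval of length at most
  \<open>2 ^ (- k)\<close>. On so short an interval the Gauss density and the densities of Lebesgue measure
  conditioned on a longer past are almost constant, so each transition probability of the chain
  exceeds the conditional Lebesgue probability of the next digit at most by the factor
  \<open>(1 + 2 ^ (- k))\<^sup>2\<close> (\<open>gauss_distortion\<close>). Consequently a cylinder of length \<open>n\<close> has measure at most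
  \<open>2 (1 + 2 ^ (- k)) ^ (2 n)\<close> times its length (\<open>chain_gauss_le\<close>). Covering an interval of length \<open>r\<close> by
  all cylinders of length \<open>n\<close> that meet it, where \<open>2 ^ (- n)\<close> is about \<open>r\<close>, yields the bound
  \<open>C r powr (1 - 2 ^ (3 - k))\<close> for its measure (\<open>cf_limit_frostman\<close>), since cylinders of length \<open>n\<close> are
  disjoint and no longer than \<open>2 ^ (- n)\<close>. The mass distribution principle (\<open>mass_distribution\<close>) turns
  this into the lower bound for the dimension of every set of full measure.
\<close>

section \<open>Sequences and cylinders\<close>

abbreviation seq_space :: "(nat \<Rightarrow> nat) measure" where
  "seq_space \<equiv> \<Pi>\<^sub>M i\<in>UNIV. count_space UNIV"

text \<open>Sequences are indexed from \<open>0\<close> and have arbitrary natural entries; an entry \<open>b\<close> stands for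
  the continued fraction digit \<open>b + 1\<close>, so that every word is admissible.\<close>

definition prefix_of :: "nat \<Rightarrow> (nat \<Rightarrow> nat) \<Rightarrow> nat list" where
  "prefix_of n \<omega> = map \<omega> [0..<n]"

definition cyl :: "nat list \<Rightarrow> (nat \<Rightarrow> nat) set" where
  "cyl w = {\<omega>. prefix_of (length w) \<omega> = w}"

lemma length_prefix_of [simp]: "length (prefix_of n \<omega>) = n"
  by (simp add: prefix_of_def)

lemma nth_prefix_of [simp]: "i < n \<Longrightarrow> prefix_of n \<omega> ! i = \<omega> i"
  by (simp add: prefix_of_def)

lemma take_prefix_of: "m \<le> n \<Longrightarrow> take m (prefix_of n \<omega>) = prefix_of m \<omega>"
  by (simp add: prefix_of_def take_map)

lemma cyl_iff: "\<omega> \<in> cyl w \<longleftrightarrow> (\<forall>i<length w. \<omega> i = w ! i)"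
  by (auto simp: cyl_def list_eq_iff_nth_eq)

lemma cyl_Nil [simp]: "cyl [] = UNIV"
  by (auto simp: cyl_iff)

lemma space_seq_space [simp]: "space seq_space = UNIV"
  by (simp add: space_PiM)

lemma measurable_coord [measurable]: "(\<lambda>\<omega>. \<omega> i) \<in> seq_space \<rightarrow>\<^sub>M count_space UNIV"
  by (rule measurable_component_singleton) simp

lemma cyl_sets [measurable]: "cyl w \<in> sets seq_space"
proof -
  have "cyl w = {\<omega> \<in> space seq_space. \<forall>i<length w. \<omega> i = w ! i}"
    by (auto simp: cyl_iff)
  also have "\<dots> \<in> sets seq_space"
    by measurable
  finally show ?thesis .
qed

lemma cyl_append: "cyl (v @ w) \<subseteq> cyl v"
  by (auto simp: cyl_iff nth_append)

lemma disjoint_cyl: "length v = length w \<Longrightarrow> v \<noteq> w \<Longrightarrow> cyl v \<inter> cyl w = {}"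
  by (auto simp: cyl_def)

lemma sets_seq_space: "sets seq_space = sigma_sets UNIV (insert {} (range cyl))"
proof
  show "sigma_sets UNIV (insert {} (range cyl)) \<subseteq> sets seq_space"
    using sets.sigma_sets_subset[of "insert {} (range cyl)" seq_space] unfolding space_seq_space
    by (metis (no_types, lifting) cyl_sets image_subsetI insert_subset sets.empty_sets)
next
  interpret S: sigma_algebra UNIV "sigma_sets UNIV (insert {} (range cyl))"
    by (rule sigma_algebra_sigma_sets) auto
  have 1: "{f \<in> UNIV \<rightarrow>\<^sub>E UNIV. f i \<in> A} \<in> sigma_sets UNIV (insert {} (range cyl))" for i :: nat and A :: "nat set"
  proof -
    have "f i \<in> A \<longleftrightarrow> prefix_of (Suc i) f ! i \<in> A" for f
      by simp
    then have "{f \<in> UNIV \<rightarrow>\<^sub>E UNIV. f i \<in> A} = (\<Union>v\<in>{v. length v = Suc i \<and> v ! i \<in> A}. cyl v)"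
      by (auto simp: cyl_def)
    also have "\<dots> \<in> sigma_sets UNIV (insert {} (range cyl))"
      by (rule S.countable_UN'') auto
    finally show ?thesis .
  qed
  show "sets seq_space \<subseteq> sigma_sets UNIV (insert {} (range cyl))"
    unfolding sets_PiM_single using 1
    by (simp del: insert_iff) (intro sigma_sets_mono, auto)
qed

lemma Int_stable_cyl: "Int_stable (insert {} (range cyl))"
proof -
  have "cyl v \<inter> cyl w \<in> insert {} (range cyl)" if "length v \<le> length w" for v w
  proof (cases "take (length v) w = v")
    case True
    then have "cyl w \<subseteq> cyl v"
      using cyl_append[of v "drop (length v) w"] by (metis append_take_drop_id)
    then show ?thesis by (auto simp: Int_absorb1)
  next
    case False
    then have "cyl v \<inter> cyl w = {}"
      using that by (auto simp: cyl_def) (metis take_prefix_of)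
    then show ?thesis by simp
  qed
  then have "cyl v \<inter> cyl w \<in> insert {} (range cyl)" for v w
    by (metis Int_commute nle_le)
  then show ?thesis by (auto simp: Int_stable_def)
qed

text \<open>Cylinders together with the empty set are closed under intersection, as two cylinders are nested or
  disjoint, and they generate the product \<open>\<sigma>\<close>-algebra.\<close>

lemma seq_measure_eqI:
  assumes "sets M = sets seq_space" "sets N = sets seq_space"
    and "\<And>w. emeasure M (cyl w) = emeasure N (cyl w)"
    and "emeasure M UNIV \<noteq> \<infinity>"
  shows "M = N"
proof (rule measure_eqI_generator_eq[OF Int_stable_cyl])
  have "cyl [] \<in> range cyl" by blast
  then show "sets M = sigma_sets UNIV (insert {} (range cyl))" "sets N = sigma_sets UNIV (insert {} (range cyl))"
    "range (\<lambda>_::nat. cyl []) \<subseteq> insert {} (range cyl)"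
    using assms by (auto simp: sets_seq_space)
qed (use assms in auto)

section \<open>Measures on sequences from weights of words\<close>

lemma Least_eq_iff:
  fixes P :: "nat \<Rightarrow> bool"
  assumes "\<exists>a. P a"
  shows "(LEAST a. P a) = n \<longleftrightarrow> P n \<and> (\<forall>b<n. \<not> P b)"
  using LeastI_ex[OF assms] by (metis not_less_Least linorder_neqE_nat)

text \<open>Consistent weights are the prospective measures of the cylinders. Existence of the measure is the
  Kolmogorov extension theorem for a countable alphabet. The locale realises it on \<open>[0,1)\<close> with Lebesgue
  measure: every word \<open>w\<close> gets a half-open interval of length \<open>W w\<close>, and the intervals of its one-letter
  extensions are laid side by side, in the order of the letters, to fill the interval of \<open>w\<close>. The
  sequence of words whose intervals contain a uniformly distributed point has the required law.\<close>

locale word_weights =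
  fixes W :: "nat list \<Rightarrow> real"
  assumes W_nonneg: "\<And>w. 0 \<le> W w"
    and W_Nil: "W [] = 1"
    and W_sums: "\<And>w. (\<lambda>a. W (w @ [a])) sums W w"
begin

definition left_end :: "nat list \<Rightarrow> real" where
  "left_end w = (\<Sum>i<length w. \<Sum>b<w ! i. W (take i w @ [b]))"

fun itinerary :: "real \<Rightarrow> nat \<Rightarrow> nat list" where
  "itinerary x 0 = []"
| "itinerary x (Suc n) = itinerary x n @
     [LEAST a. x < left_end (itinerary x n) + (\<Sum>b\<le>a. W (itinerary x n @ [b]))]"

lemma left_end_Nil [simp]: "left_end [] = 0"
  by (simp add: left_end_def)

lemma left_end_snoc: "left_end (w @ [a]) = left_end w + (\<Sum>b<a. W (w @ [b]))"
proof -
  have "(\<Sum>i<length w. \<Sum>b<(w @ [a]) ! i. W (take i (w @ [a]) @ [b])) =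
        (\<Sum>i<length w. \<Sum>b<w ! i. W (take i w @ [b]))"
    by (intro sum.cong) (auto simp: nth_append)
  then show ?thesis by (simp add: left_end_def)
qed

lemma length_itinerary [simp]: "length (itinerary x n) = n"
  by (induction n) auto

text \<open>Half-open intervals are essential: since the weights of the extensions of \<open>w\<close> sum to \<open>W w\<close>, their
  intervals tile that of \<open>w\<close> without remainder, so the greedy choice of the next letter always exists.\<close>

lemma itinerary_iff:
  assumes "x \<in> {0..<1}"
  shows "itinerary x (length w) = w \<longleftrightarrow> x \<in> {left_end w..<left_end w + W w}"
proof (induction w rule: rev_induct)
  case Nil
  then show ?case using assms by (simp add: W_Nil)
next
  case (snoc a w)
  let ?S = "\<lambda>a. left_end w + (\<Sum>b\<le>a. W (w @ [b]))"
  have mono: "?S a \<le> ?S a'" if "a \<le> a'" for a a'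
    using that by (auto intro!: sum_mono2 W_nonneg)
  have le: "(\<Sum>b\<le>a. W (w @ [b])) \<le> W w"
    using W_sums[of w] sum_le_suminf[of "\<lambda>a. W (w @ [a])" "{..a}"] W_nonneg
    by (auto simp: sums_iff)
  have ex: "\<exists>a. x < ?S a" if "x < left_end w + W w"
  proof -
    have "(\<lambda>n. \<Sum>b\<le>n. W (w @ [b])) \<longlonglongrightarrow> W w"
      using W_sums[of w] by (simp add: sums_def_le)
    then have "eventually (\<lambda>n. x - left_end w < (\<Sum>b\<le>n. W (w @ [b]))) sequentially"
      using that by (intro order_tendstoD) auto
    then show ?thesis
      by (auto simp: eventually_sequentially algebra_simps intro: exI)
  qed
  have lt: "{..<a} = (if a = 0 then {} else {..a - 1})" by (cases a) (auto simp: lessThan_Suc_atMost)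
  have "(itinerary x (length (w @ [a])) = w @ [a]) \<longleftrightarrow>
      x \<in> {left_end w..<left_end w + W w} \<and> (LEAST a. x < ?S a) = a"
    using snoc by auto
  also have "\<dots> \<longleftrightarrow> x \<in> {left_end w..<left_end w + W w} \<and> x < ?S a \<and> (\<forall>b<a. \<not> x < ?S b)"
  proof (cases "x < left_end w + W w")
    case True
    then show ?thesis using Least_eq_iff[OF ex[OF True], of a] by simp
  qed simp
  also have "\<dots> \<longleftrightarrow> x \<in> {left_end w..<left_end w + W w} \<and> x < ?S a \<and>
       left_end w + (\<Sum>b<a. W (w @ [b])) \<le> x"
  proof (cases "a = 0")
    case False
    then have "(\<forall>b<a. \<not> x < ?S b) \<longleftrightarrow> \<not> x < ?S (a - 1)"
    proof (intro iffI allI impI)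
      fix b assume "\<not> x < ?S (a - 1)" "b < a"
      then show "\<not> x < ?S b" using mono[of b "a - 1"] by linarith
    qed (use False in simp)
    then show ?thesis using False by (simp add: lt not_less)
  qed auto
  also have "\<dots> \<longleftrightarrow> x \<in> {left_end (w @ [a])..<left_end (w @ [a]) + W (w @ [a])}"
  proof -
    have pos: "0 \<le> (\<Sum>b<a. W (w @ [b]))" by (intro sum_nonneg W_nonneg)
    have split: "(\<Sum>b\<le>a. W (w @ [b])) = (\<Sum>b<a. W (w @ [b])) + W (w @ [a])"
      by (simp flip: lessThan_Suc_atMost)
    show ?thesis
      unfolding left_end_snoc atLeastLessThan_iff using pos le unfolding split by linarith
  qed
  finally show ?case .
qed

lemma left_end_bounds: "0 \<le> left_end w \<and> left_end w + W w \<le> 1"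
proof (induction w rule: rev_induct)
  case (snoc a w)
  have "(\<Sum>b\<le>a. W (w @ [b])) \<le> W w"
    using W_sums[of w] sum_le_suminf[of "\<lambda>a. W (w @ [a])" "{..a}"] W_nonneg
    by (auto simp: sums_iff)
  moreover have "0 \<le> (\<Sum>b<a. W (w @ [b]))" by (intro sum_nonneg W_nonneg)
  moreover have "(\<Sum>b\<le>a. W (w @ [b])) = (\<Sum>b<a. W (w @ [b])) + W (w @ [a])"
    by (simp flip: lessThan_Suc_atMost)
  ultimately show ?case using snoc by (auto simp: left_end_snoc)
qed (simp add: W_Nil)

definition unit_leb :: "real measure" where
  "unit_leb = restrict_space lborel {0..<1}"

definition digits :: "real \<Rightarrow> nat \<Rightarrow> nat" where
  "digits x n = last (itinerary x (Suc n))"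

lemma prefix_digits: "prefix_of n (digits x) = itinerary x n"
  by (induction n) (simp_all add: prefix_of_def digits_def)

lemma itinerary_sets: "{x \<in> space unit_leb. itinerary x (length w) = w} = {left_end w..<left_end w + W w}"
  using left_end_bounds[of w] itinerary_iff[of _ w] by (auto simp: unit_leb_def space_restrict_space)

lemma measurable_digits: "digits \<in> unit_leb \<rightarrow>\<^sub>M seq_space"
proof (rule measurable_PiM_single')
  fix i :: nat
  show "(\<lambda>x. digits x i) \<in> unit_leb \<rightarrow>\<^sub>M count_space UNIV"
    unfolding digits_def
  proof (rule measurable_compose[where g = last and N = "count_space UNIV"])
    show "(\<lambda>x. itinerary x (Suc i)) \<in> unit_leb \<rightarrow>\<^sub>M count_space UNIV"
    proof (subst measurable_count_space_eq2_countable, intro conjI ballI)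
      fix w :: "nat list"
      show "(\<lambda>x. itinerary x (Suc i)) -` {w} \<inter> space unit_leb \<in> sets unit_leb"
      proof (cases "length w = Suc i")
        case True
        have "(\<lambda>x. itinerary x (Suc i)) -` {w} \<inter> space unit_leb = {left_end w..<left_end w + W w}"
          using itinerary_sets[of w] unfolding True by (simp add: vimage_def Int_def conj_commute del: itinerary.simps)
        also have "\<dots> \<in> sets unit_leb"
          using left_end_bounds[of w]
          by (subst unit_leb_def, subst sets_restrict_space_iff) auto
        finally show ?thesis .
      next
        case False
        then have "(\<lambda>x. itinerary x (Suc i)) -` {w} \<inter> space unit_leb = {}"
          using length_itinerary[of _ "Suc i"] by (auto simp del: itinerary.simps)
        then show ?thesis by simp
      qed
    qed auto
  qed auto
qed auto

theorem extension_exists: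
  "\<exists>M. sets M = sets seq_space \<and> prob_space M \<and> (\<forall>w. emeasure M (cyl w) = ennreal (W w))"
proof (intro exI conjI allI)
  let ?M = "distr unit_leb seq_space digits"
  show *: "emeasure ?M (cyl w) = ennreal (W w)" for w
  proof -
    have "emeasure ?M (cyl w) = emeasure unit_leb (digits -` cyl w \<inter> space unit_leb)"
      by (rule emeasure_distr[OF measurable_digits cyl_sets])
    also have "digits -` cyl w \<inter> space unit_leb = {left_end w..<left_end w + W w}"
      using itinerary_sets[of w] by (auto simp: cyl_def prefix_digits)
    also have "emeasure unit_leb \<dots> = W w"
      using left_end_bounds[of w] W_nonneg[of w]
      by (auto simp: unit_leb_def emeasure_restrict_space)
    finally show ?thesis .
  qed
  show "prob_space ?M"
    by (rule prob_spaceI) (use *[of "[]"] in \<open>simp add: W_Nil\<close>)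
qed simp

end

section \<open>Shifting and prepending\<close>

definition shift_seq :: "nat \<Rightarrow> (nat \<Rightarrow> nat) \<Rightarrow> nat \<Rightarrow> nat" where
  "shift_seq n \<omega> i = \<omega> (i + n)"

definition prepend :: "nat list \<Rightarrow> (nat \<Rightarrow> nat) \<Rightarrow> nat \<Rightarrow> nat" where
  "prepend v \<omega> i = (if i < length v then v ! i else \<omega> (i - length v))"

lemma measurable_shift_seq [measurable]: "shift_seq n \<in> seq_space \<rightarrow>\<^sub>M seq_space"
  unfolding shift_seq_def by (rule measurable_PiM_single') (auto intro: measurable_coord)

lemma measurable_prepend [measurable]: "prepend v \<in> seq_space \<rightarrow>\<^sub>M seq_space"
proof (rule measurable_PiM_single')
  show "(\<lambda>\<omega>. prepend v \<omega> i) \<in> seq_space \<rightarrow>\<^sub>M count_space UNIV" for i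
    by (cases "i < length v") (auto simp: prepend_def intro: measurable_coord)
qed auto

lemma sets_shift_vimage [measurable]: "F \<in> sets seq_space \<Longrightarrow> shift_seq n -` F \<in> sets seq_space"
  using measurable_sets[OF measurable_shift_seq] by simp

lemma sets_prepend_vimage [measurable]: "F \<in> sets seq_space \<Longrightarrow> prepend v -` F \<in> sets seq_space"
  using measurable_sets[OF measurable_prepend] by simp

lemma shift_seq_add: "shift_seq m (shift_seq n \<omega>) = shift_seq (m + n) \<omega>"
  by (simp add: shift_seq_def fun_eq_iff add.assoc)

lemma shift_seq_0 [simp]: "shift_seq 0 = id"
  by (auto simp: shift_seq_def fun_eq_iff)

lemma shift_vimage_add: "shift_seq n -` (shift_seq m -` F) = shift_seq (m + n) -` F"
  by (auto simp: shift_seq_add)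

lemma prepend_shift: "\<omega> \<in> cyl v \<Longrightarrow> prepend v (shift_seq (length v) \<omega>) = \<omega>"
  by (auto simp: prepend_def shift_seq_def cyl_iff fun_eq_iff)

lemma shift_prepend: "shift_seq (length v) (prepend v \<omega>) = \<omega>"
  by (auto simp: prepend_def shift_seq_def fun_eq_iff)

lemma cyl_append_eq: "cyl (v @ w) = cyl v \<inter> shift_seq (length v) -` cyl w"
proof -
  have "(\<forall>i<length v + length w. \<omega> i = (v @ w) ! i) \<longleftrightarrow>
      (\<forall>i<length v. \<omega> i = v ! i) \<and> (\<forall>i<length w. \<omega> (i + length v) = w ! i)" for \<omega> :: "nat \<Rightarrow> nat"
  proof (intro iffI conjI allI impI)
    fix i assume *: "\<forall>i<length v + length w. \<omega> i = (v @ w) ! i"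
    { assume "i < length v" then show "\<omega> i = v ! i" using *[rule_format, of i] by (simp add: nth_append) }
    { assume "i < length w" then show "\<omega> (i + length v) = w ! i" using *[rule_format, of "i + length v"] by (simp add: nth_append) }
  next
    fix i assume "(\<forall>i<length v. \<omega> i = v ! i) \<and> (\<forall>i<length w. \<omega> (i + length v) = w ! i)" "i < length v + length w"
    then show "\<omega> i = (v @ w) ! i"
      by (cases "i < length v") (auto simp: nth_append dest!: spec[of _ "i - length v"])
  qed
  then show ?thesis by (auto simp: cyl_iff shift_seq_def)
qed

text \<open>There are only countably many words, so an event about the first \<open>n\<close> entries is a countable disjoint
  union of cylinders.\<close>

lemma emeasure_prefix_UN:
  assumes "sets M = sets seq_space" "X \<in> sets seq_space"
  shows "emeasure M ({\<omega>. prefix_of n \<omega> \<in> U} \<inter> X) =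
    (\<integral>\<^sup>+ v. emeasure M (cyl v \<inter> X) \<partial>count_space {v \<in> U. length v = n})"
proof -
  have "{\<omega>. prefix_of n \<omega> \<in> U} \<inter> X = (\<Union>v\<in>{v \<in> U. length v = n}. cyl v \<inter> X)"
    by (auto simp: cyl_def)
  also have "emeasure M \<dots> = (\<integral>\<^sup>+ v. emeasure M (cyl v \<inter> X) \<partial>count_space {v \<in> U. length v = n})"
  proof (rule emeasure_UN_countable)
    show "cyl v \<inter> X \<in> sets M" for v
      using assms by (metis cyl_sets sets.Int)
    show "disjoint_family_on (\<lambda>v. cyl v \<inter> X) {v \<in> U. length v = n}"
      using disjoint_cyl by (fastforce simp: disjoint_family_on_def)
  qed simp
  finally show ?thesis .
qed

section \<open>Mixing of finite-memory weights\<close>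

text \<open>Doeblin's argument. If \<open>P\<close> dominates \<open>c P'\<close>, then \<open>P = c P' + Q\<close> with \<open>Q\<close> of mass \<open>1 - c\<close>; the common part
  \<open>c P'\<close> contributes the same to both averages of \<open>h\<close>, so only the fraction \<open>1 - c\<close> of the oscillation
  of \<open>h\<close> survives.\<close>

lemma doeblin_contraction:
  fixes P P' :: "'a \<Rightarrow> real" and h :: "'a \<Rightarrow> ennreal"
  assumes P: "\<And>v. v \<in> A \<Longrightarrow> 0 \<le> P' v" "(\<integral>\<^sup>+v. P v \<partial>count_space A) = 1" "(\<integral>\<^sup>+v. P' v \<partial>count_space A) = 1"
    and c: "0 \<le> c" "c \<le> 1" "\<And>v. v \<in> A \<Longrightarrow> c * P' v \<le> P v"
    and h: "\<And>v v'. v \<in> A \<Longrightarrow> v' \<in> A \<Longrightarrow> h v \<le> h v' + d"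
  shows "(\<integral>\<^sup>+v. P v * h v \<partial>count_space A) \<le> (\<integral>\<^sup>+v. P' v * h v \<partial>count_space A) + ennreal (1 - c) * d"
proof -
  define Q where "Q v = P v - c * P' v" for v
  have P_eq: "ennreal (P v) = ennreal (Q v) + ennreal c * ennreal (P' v)" if "v \<in> A" for v
    using c(1) c(3)[OF that] P(1)[OF that]
    by (simp add: Q_def ennreal_mult'[symmetric] ennreal_plus[symmetric] del: ennreal_plus)
  let ?I = "\<lambda>f. \<integral>\<^sup>+v. f v \<partial>count_space A"
  have "1 = ?I (\<lambda>v. ennreal (Q v) + ennreal c * ennreal (P' v))"
    unfolding P(2)[symmetric] by (rule nn_integral_cong) (simp add: P_eq)
  also have "\<dots> = ?I (\<lambda>v. ennreal (Q v)) + ennreal c"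
    by (simp add: nn_integral_add nn_integral_cmult P(3))
  finally have "?I (\<lambda>v. ennreal (Q v)) = 1 - ennreal c"
    by (metis ennreal_add_diff_cancel_right ennreal_neq_top)
  also have "\<dots> = ennreal (1 - c)"
    using c ennreal_minus[of c 1] by simp
  finally have Q1: "?I (\<lambda>v. ennreal (Q v)) = ennreal (1 - c)" .
  have 1: "?I (\<lambda>v. P v * h v) \<le> ennreal (1 - c) * (h v' + d) + ennreal c * ?I (\<lambda>v. P' v * h v)"
    if v': "v' \<in> A" for v'
  proof -
    have "?I (\<lambda>v. P v * h v) = ?I (\<lambda>v. ennreal (Q v) * h v + ennreal c * (P' v * h v))"
      by (intro nn_integral_cong) (simp add: P_eq algebra_simps)
    also have "\<dots> = ?I (\<lambda>v. ennreal (Q v) * h v) + ennreal c * ?I (\<lambda>v. P' v * h v)"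
      by (simp add: nn_integral_add nn_integral_cmult)
    also have "?I (\<lambda>v. ennreal (Q v) * h v) \<le> ?I (\<lambda>v. ennreal (Q v) * (h v' + d))"
      using h v' by (intro nn_integral_mono mult_left_mono) auto
    also have "\<dots> = ennreal (1 - c) * (h v' + d)"
      by (simp add: nn_integral_multc Q1)
    finally show ?thesis by (simp add: add_mono)
  qed
  have "?I (\<lambda>v. P v * h v) = ?I (\<lambda>v'. ennreal (P' v') * ?I (\<lambda>v. P v * h v))"
    by (simp add: nn_integral_multc P(3))
  also have "\<dots> \<le> ?I (\<lambda>v'. ennreal (P' v') * (ennreal (1 - c) * (h v' + d) + ennreal c * ?I (\<lambda>v. P' v * h v)))"
    using 1 by (intro nn_integral_mono mult_left_mono) auto
  also have "\<dots> = ?I (\<lambda>v'. ennreal (1 - c) * (ennreal (P' v') * h v') +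
       ennreal (P' v') * (ennreal (1 - c) * d + ennreal c * ?I (\<lambda>v. P' v * h v)))"
    by (intro nn_integral_cong) (simp add: algebra_simps)
  also have "\<dots> = ennreal (1 - c) * ?I (\<lambda>v. P' v * h v) + (ennreal (1 - c) * d + ennreal c * ?I (\<lambda>v. P' v * h v))"
    by (simp add: nn_integral_add nn_integral_cmult nn_integral_multc P(3))
  also have "\<dots> = (ennreal (1 - c) + ennreal c) * ?I (\<lambda>v. P' v * h v) + ennreal (1 - c) * d"
    by (simp add: algebra_simps)
  also have "ennreal (1 - c) + ennreal c = 1"
    using c by (simp add: ennreal_plus[symmetric] del: ennreal_plus)
  finally show ?thesis by simp
qed

definition digit_process :: "nat \<Rightarrow> (nat \<Rightarrow> nat) \<Rightarrow> nat" where
  "digit_process n \<omega> = Suc (\<omega> (n - 1))"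

text \<open>Weights of a stationary process with memory \<open>k\<close> whose past and future are independent up to a
  factor \<open>K\<close>. Left consistency, together with the right consistency of the weights, expresses stationarity.
  The two-sided bound by \<open>K\<close> already contains a Doeblin condition, and with it geometric \<open>\<psi>\<close>-mixing.\<close>

locale markov_weights = word_weights W for W +
  fixes k :: nat and K :: real
  assumes k_pos: "0 < k"
    and W_pos: "\<And>w. 0 < W w"
    and W_left: "\<And>w. (\<lambda>b. W (b # w)) sums W w"
    and W_markov: "\<And>u v w. length v = k \<Longrightarrow> W (u @ v @ w) * W v = W (u @ v) * W (v @ w)"
    and W_upper: "\<And>u v. W (u @ v) \<le> K * W u * W v"
    and W_lower: "\<And>u v. W u * W v \<le> K * W (u @ v)"
begin

lemma K_ge_1: "1 \<le> K"
  using W_upper[of "[]" "[]"] by (simp add: W_Nil)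

definition cond_weight :: "nat list \<Rightarrow> nat list \<Rightarrow> real" where
  "cond_weight u v = W (u @ v) / W u"

lemma cond_weight_pos: "0 < cond_weight u v"
  by (simp add: cond_weight_def W_pos)

lemma cond_weight_nonneg: "0 \<le> cond_weight u v"
  using cond_weight_pos[of u v] by simp

lemma cond_weight_Nil [simp]: "cond_weight [] v = W v"
  by (simp add: cond_weight_def W_Nil)

lemma cond_weight_upper: "cond_weight u v \<le> K * W v"
  using W_upper[of u v] W_pos[of u] by (simp add: cond_weight_def field_simps)

lemma cond_weight_lower: "W v \<le> K * cond_weight u v"
  using W_lower[of u v] W_pos[of u] by (simp add: cond_weight_def field_simps)

lemma word_weights_cond_weight: "word_weights (cond_weight u)"
proof
  show "0 \<le> cond_weight u w" for w by (rule cond_weight_nonneg)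
  show "cond_weight u [] = 1" using W_pos[of u] by (simp add: cond_weight_def)
  show "(\<lambda>a. cond_weight u (w @ [a])) sums cond_weight u w" for w
    using sums_divide[OF W_sums[of "u @ w"], of "W u"] by (simp add: cond_weight_def)
qed

text \<open>The law of the future after the past \<open>u\<close>; the empty past gives the law of the process itself. The
  measures are obtained from the extension theorem, not by conditioning, which makes each of them a
  probability measure on the same space, determined by its values on cylinders.\<close>

definition law :: "nat list \<Rightarrow> (nat \<Rightarrow> nat) measure" where
  "law u = (SOME M. sets M = sets seq_space \<and> prob_space M \<and> (\<forall>w. emeasure M (cyl w) = ennreal (cond_weight u w)))"

lemma law: "sets (law u) = sets seq_space \<and> prob_space (law u) \<and> (\<forall>w. emeasure (law u) (cyl w) = ennreal (cond_weight u w))"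
  unfolding law_def
  by (rule someI_ex[OF word_weights.extension_exists[OF word_weights_cond_weight]])

lemma sets_law [simp, measurable_cong]: "sets (law u) = sets seq_space"
  using law by blast

lemma space_law [simp]: "space (law u) = UNIV"
  using sets_eq_imp_space_eq[OF sets_law] by simp

lemma prob_space_law: "prob_space (law u)"
  using law by blast

lemma law_cyl: "emeasure (law u) (cyl w) = ennreal (cond_weight u w)"
  using law by blast

lemma law_UNIV [simp]: "emeasure (law u) UNIV = 1"
  using prob_space.emeasure_space_1[OF prob_space_law, of u] by simp

text \<open>Both sides are measures in \<open>F\<close>, so it suffices that they agree on cylinders, where the identity is
  the cancellation of weights.\<close>

lemma law_cyl_shift:
  assumes [measurable]: "F \<in> sets seq_space"
  shows "emeasure (law u) (cyl v \<inter> shift_seq (length v) -` F) = cond_weight u v * emeasure (law (u @ v)) F"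
proof -
  let ?A = "distr (density (law u) (indicator (cyl v))) seq_space (shift_seq (length v))"
  let ?B = "scale_measure (cond_weight u v) (law (u @ v))"
  have A: "emeasure ?A F = emeasure (law u) (cyl v \<inter> shift_seq (length v) -` F)"
    if [measurable]: "F \<in> sets seq_space" for F
    by (subst emeasure_distr) (auto simp: emeasure_restricted)
  have "?A = ?B"
  proof (rule seq_measure_eqI)
    show "emeasure ?A (cyl w) = emeasure ?B (cyl w)" for w
    proof -
      have "emeasure ?A (cyl w) = ennreal (cond_weight u (v @ w))"
        by (simp add: A law_cyl flip: cyl_append_eq)
      also have "cond_weight u (v @ w) = cond_weight u v * cond_weight (u @ v) w"
        using W_pos[of "u @ v"] by (simp add: cond_weight_def)
      finally show ?thesis
        by (simp add: law_cyl ennreal_mult cond_weight_nonneg)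
    qed
    have "emeasure ?A UNIV = emeasure (law u) (cyl v)"
      using A[of UNIV] sets.top[of seq_space] by simp
    then show "emeasure ?A UNIV \<noteq> \<infinity>" by (simp add: law_cyl)
  qed simp_all
  then show ?thesis using A[OF assms] by simp
qed

lemma law_markov:
  assumes "length v = k"
  shows "law (u @ v) = law v"
proof (rule seq_measure_eqI)
  show "emeasure (law (u @ v)) (cyl w) = emeasure (law v) (cyl w)" for w
  proof -
    have "cond_weight (u @ v) w = cond_weight v w"
      using W_markov[OF assms, of u w] W_pos[of v] W_pos[of "u @ v"]
      by (simp add: cond_weight_def frac_eq_eq mult.commute)
    then show ?thesis by (simp add: law_cyl)
  qed
qed simp_all

abbreviation words :: "nat list set" where
  "words \<equiv> {v. length v = k}"

lemma law_disintegrate: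
  assumes [measurable]: "F \<in> sets seq_space"
  shows "emeasure (law u) F = (\<integral>\<^sup>+v. cond_weight u v * emeasure (law v) (prepend v -` F) \<partial>count_space words)"
proof -
  have "emeasure (law u) F = (\<integral>\<^sup>+v. emeasure (law u) (cyl v \<inter> F) \<partial>count_space words)"
    using emeasure_prefix_UN[of "law u" F k UNIV] by simp
  also have "\<dots> = (\<integral>\<^sup>+v. cond_weight u v * emeasure (law v) (prepend v -` F) \<partial>count_space words)"
  proof (rule nn_integral_cong)
    fix v assume "v \<in> space (count_space words)"
    then have v: "length v = k" by simp
    have "cyl v \<inter> F = cyl v \<inter> shift_seq (length v) -` (prepend v -` F)"
      by (auto simp: prepend_shift)
    then show "emeasure (law u) (cyl v \<inter> F) = cond_weight u v * emeasure (law v) (prepend v -` F)"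
      using law_cyl_shift[of "prepend v -` F" u v] by (simp add: law_markov[OF v])
  qed
  finally show ?thesis .
qed

lemma cond_weight_sum: "(\<integral>\<^sup>+v. cond_weight u v \<partial>count_space words) = 1"
  using law_disintegrate[of UNIV u] sets.top[of seq_space] by simp

text \<open>Cylinders satisfy this bound by assumption, but an inequality does not pass to all events by a
  \<open>\<pi>\<close>-system argument. Disintegrating over the first \<open>k\<close> letters helps: afterwards the laws no longer depend
  on \<open>u\<close>, so only the weights of the words of length \<open>k\<close> have to be compared.\<close>

lemma law_comparable:
  assumes [measurable]: "F \<in> sets seq_space"
  shows "emeasure (law u) F \<le> ennreal K * emeasure (law []) F"
proof -
  have "emeasure (law u) F \<le>
      (\<integral>\<^sup>+v. ennreal K * (ennreal (W v) * emeasure (law v) (prepend v -` F)) \<partial>count_space words)"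
    unfolding law_disintegrate[OF assms, of u]
  proof (rule nn_integral_mono)
    fix v
    have "ennreal (cond_weight u v) \<le> ennreal K * ennreal (W v)"
      using cond_weight_upper[of u v] W_nonneg[of v] K_ge_1 by (simp add: ennreal_mult[symmetric] ennreal_leI)
    then show "ennreal (cond_weight u v) * emeasure (law v) (prepend v -` F)
        \<le> ennreal K * (ennreal (W v) * emeasure (law v) (prepend v -` F))"
      by (simp add: mult.assoc[symmetric] mult_right_mono)
  qed
  also have "\<dots> = ennreal K * emeasure (law []) F"
    by (simp add: nn_integral_cmult law_disintegrate[OF assms, of "[]"])
  finally show ?thesis .
qed

definition rate :: real where "rate = 1 - 1 / K\<^sup>2"

lemma rate: "0 \<le> rate" "rate < 1"
  using K_ge_1 one_le_power[of K 2] by (auto simp: rate_def field_simps)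

text \<open>An event that lies \<open>k * j\<close> steps in the future depends on the past only through \<open>j\<close> successive blocks of
  length \<open>k\<close>. Each block forgets the previous one with probability at least \<open>1 / K\<^sup>2\<close>. The initial oscillation is
  bounded by a multiple of the probability of the event, which makes the resulting mixing bound
  multiplicative.\<close>

lemma oscillation_bound:
  assumes [measurable]: "F \<in> sets seq_space"
  shows "emeasure (law u) (shift_seq (k * j) -` F) \<le>
    emeasure (law u') (shift_seq (k * j) -` F) + ennreal (rate ^ j) * (ennreal K * emeasure (law []) F)"
proof (induction j arbitrary: u u')
  case 0
  then show ?case using law_comparable[of F u] by (simp add: add_increasing)
next
  case (Suc j)
  let ?F = "shift_seq (k * j) -` F"
  let ?d = "ennreal (rate ^ j) * (ennreal K * emeasure (law []) F)"
  have *: "emeasure (law u) (shift_seq (k * Suc j) -` F) =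
      (\<integral>\<^sup>+v. cond_weight u v * emeasure (law v) ?F \<partial>count_space words)" for u
  proof -
    have "prepend v -` (shift_seq (k * Suc j) -` F) = ?F" if "length v = k" for v
    proof -
      have "shift_seq (k * Suc j) (prepend v \<omega>) = shift_seq (k * j) \<omega>" for \<omega>
        using shift_prepend[of v \<omega>] shift_seq_add[of "k * j" k "prepend v \<omega>"] that by (simp add: add.commute)
      then show ?thesis by auto
    qed
    then show ?thesis
      by (subst law_disintegrate) (auto intro!: nn_integral_cong)
  qed
  have "(\<integral>\<^sup>+v. cond_weight u v * emeasure (law v) ?F \<partial>count_space words) \<le>
      (\<integral>\<^sup>+v. cond_weight u' v * emeasure (law v) ?F \<partial>count_space words) + ennreal (1 - 1 / K\<^sup>2) * ?d"
  proof (rule doeblin_contraction)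
    show "1 / K\<^sup>2 * cond_weight u' v \<le> cond_weight u v" for v
    proof -
      have "cond_weight u' v \<le> K * (K * cond_weight u v)"
      proof (rule order_trans[OF cond_weight_upper])
        show "K * W v \<le> K * (K * cond_weight u v)"
          using cond_weight_lower[of v u] K_ge_1 by (intro mult_left_mono) auto
      qed
      then show ?thesis using K_ge_1 by (simp add: field_simps power2_eq_square)
    qed
    show "0 \<le> 1 / K\<^sup>2" "1 / K\<^sup>2 \<le> 1"
      using rate by (auto simp: rate_def)
  qed (use Suc in \<open>auto simp: cond_weight_nonneg cond_weight_sum\<close>)
  also have "ennreal (1 - 1 / K\<^sup>2) * ?d = ennreal (rate ^ Suc j) * (ennreal K * emeasure (law []) F)"
    using rate by (simp add: rate_def[symmetric] ennreal_mult mult.assoc)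
  finally show ?case unfolding * .
qed

lemma stationary: "distr (law []) seq_space (shift_seq n) = law []"
proof (induction n)
  case 0
  then show ?case by (simp add: id_def distr_id2)
next
  case (Suc n)
  have 1: "distr (law []) seq_space (shift_seq 1) = law []"
  proof (rule seq_measure_eqI)
    show "emeasure (distr (law []) seq_space (shift_seq 1)) (cyl w) = emeasure (law []) (cyl w)" for w
    proof -
      have "shift_seq 1 -` cyl w = (\<Union>b. cyl (b # w))"
        using cyl_append_eq[of "[b]" w for b] by (auto simp: cyl_iff)
      then have "emeasure (distr (law []) seq_space (shift_seq 1)) (cyl w) = emeasure (law []) (\<Union>b. cyl (b # w))"
        by (subst emeasure_distr) auto
      also have "\<dots> = (\<Sum>b. emeasure (law []) (cyl (b # w)))"
      proof (rule suminf_emeasure[symmetric])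
        show "disjoint_family (\<lambda>b. cyl (b # w))"
          unfolding disjoint_family_on_def by (auto intro!: disjoint_cyl)
      qed auto
      also have "\<dots> = (\<Sum>b. ennreal (W (b # w)))"
        by (simp add: law_cyl)
      also have "\<dots> = ennreal (W w)"
        using W_left[of w] by (intro suminf_ennreal_eq W_nonneg)
      finally show ?thesis by (simp add: law_cyl)
    qed
    show "emeasure (distr (law []) seq_space (shift_seq 1)) UNIV \<noteq> \<infinity>"
      using sets.top[of seq_space] by (subst emeasure_distr) auto
  qed simp_all
  have "shift_seq (Suc n) = shift_seq 1 \<circ> shift_seq n"
    by (auto simp: fun_eq_iff shift_seq_def)
  then have "distr (law []) seq_space (shift_seq (Suc n)) =
      distr (distr (law []) seq_space (shift_seq n)) seq_space (shift_seq 1)"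
    by (simp add: distr_distr)
  then show ?case using Suc 1 by simp
qed

lemma law_shift: "F \<in> sets seq_space \<Longrightarrow> emeasure (law []) (shift_seq n -` F) = emeasure (law []) F"
  using stationary[of n] emeasure_distr[of "shift_seq n" "law []" seq_space F]
  by (simp add: measurable_cong_sets[OF sets_law refl])

text \<open>Only complete blocks of length \<open>k\<close> inside the gap contribute a contraction, whence the integer
  division. For small gaps the constant \<open>K\<close> alone is the bound.\<close>

definition mix :: "nat \<Rightarrow> real" where
  "mix n = K * rate ^ ((n - 1) div k)"

lemma mix_nonneg: "0 \<le> mix n"
  using K_ge_1 rate by (simp add: mix_def)

text \<open>The events \<open>E\<close> and \<open>F\<close> in the definition of \<open>\<psi>\<close>-mixing with gap \<open>n\<close> leave \<open>n - 1\<close> letters between them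
  undetermined. Of these, \<open>(n - 1) mod k\<close> letters do not fill a block and are absorbed into the event.\<close>

lemma law_mixing:
  assumes [measurable]: "F \<in> sets seq_space" and n: "1 \<le> n"
  shows "emeasure (law u) (shift_seq (n - 1) -` F) \<le> emeasure (law []) F + ennreal (mix n) * emeasure (law []) F"
    and "emeasure (law []) F \<le> emeasure (law u) (shift_seq (n - 1) -` F) + ennreal (mix n) * emeasure (law []) F"
proof -
  define j r where "j = (n - 1) div k" and "r = (n - 1) mod k"
  have nr: "r + k * j = n - 1" by (simp add: j_def r_def)
  let ?F = "shift_seq r -` F"
  have 1: "shift_seq (k * j) -` ?F = shift_seq (n - 1) -` F"
    by (simp add: shift_vimage_add nr)
  have 2: "ennreal (rate ^ j) * (ennreal K * emeasure (law []) ?F) = ennreal (mix n) * emeasure (law []) F"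
    using rate K_ge_1 by (simp add: law_shift mix_def j_def ennreal_mult ac_simps)
  show "emeasure (law u) (shift_seq (n - 1) -` F) \<le> emeasure (law []) F + ennreal (mix n) * emeasure (law []) F"
    using oscillation_bound[of ?F u j "[]"] unfolding 1 2 by (simp add: law_shift)
  show "emeasure (law []) F \<le> emeasure (law u) (shift_seq (n - 1) -` F) + ennreal (mix n) * emeasure (law []) F"
    using oscillation_bound[of ?F "[]" j u] unfolding 1 2 by (simp add: law_shift)
qed

lemma joint_mixing:
  fixes U :: "nat list set" and m n :: nat
  assumes [measurable]: "F \<in> sets seq_space" and n: "1 \<le> n"
  defines "E \<equiv> {\<omega>. prefix_of m \<omega> \<in> U}" and "G \<equiv> shift_seq (m + n - 1) -` F"
  shows "\<bar>measure (law []) (E \<inter> G) - measure (law []) E * measure (law []) G\<bar>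
     \<le> mix n * measure (law []) E * measure (law []) G"
proof -
  interpret prob_space "law []" by (rule prob_space_law)
  let ?A = "{u \<in> U. length u = m}"
  let ?M = "emeasure (law [])"
  have MG: "?M G = ?M F" by (simp add: G_def law_shift)
  have G_eq: "G = shift_seq m -` (shift_seq (n - 1) -` F)"
    using n by (simp add: G_def shift_vimage_add add.commute)
  have EG: "?M (E \<inter> G) = (\<integral>\<^sup>+u. W u * emeasure (law u) (shift_seq (n - 1) -` F) \<partial>count_space ?A)"
  proof -
    have "?M (E \<inter> G) = (\<integral>\<^sup>+u. ?M (cyl u \<inter> G) \<partial>count_space ?A)"
      unfolding E_def by (rule emeasure_prefix_UN) (simp_all add: G_def)
    also have "\<dots> = (\<integral>\<^sup>+u. W u * emeasure (law u) (shift_seq (n - 1) -` F) \<partial>count_space ?A)"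
    proof (rule nn_integral_cong)
      fix u assume "u \<in> space (count_space ?A)"
      then have "length u = m" by simp
      then show "?M (cyl u \<inter> G) = W u * emeasure (law u) (shift_seq (n - 1) -` F)"
        unfolding G_eq using law_cyl_shift[of "shift_seq (n - 1) -` F" "[]" u] by simp
    qed
    finally show ?thesis .
  qed
  have E: "?M E = (\<integral>\<^sup>+u. W u \<partial>count_space ?A)"
    using emeasure_prefix_UN[of "law []" UNIV m U] sets.top[of seq_space] by (simp add: E_def law_cyl)
  have "?M (E \<inter> G) \<le> (\<integral>\<^sup>+u. W u * (?M F + ennreal (mix n) * ?M F) \<partial>count_space ?A)"
    unfolding EG using law_mixing(1)[OF assms(1) n] by (intro nn_integral_mono mult_left_mono) auto
  also have "\<dots> = ?M E * (?M F + ennreal (mix n) * ?M F)"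
    by (simp add: nn_integral_multc E)
  also have "\<dots> = ?M E * ?M G + ennreal (mix n) * ?M E * ?M G"
    by (simp add: MG distrib_left ac_simps)
  finally have upper: "?M (E \<inter> G) \<le> ?M E * ?M G + ennreal (mix n) * ?M E * ?M G" .
  have "?M E * ?M G = (\<integral>\<^sup>+u. W u * ?M F \<partial>count_space ?A)"
    by (simp add: nn_integral_multc E MG)
  also have "\<dots> \<le> (\<integral>\<^sup>+u. W u * (emeasure (law u) (shift_seq (n - 1) -` F) + ennreal (mix n) * ?M F) \<partial>count_space ?A)"
    using law_mixing(2)[OF assms(1) n] by (intro nn_integral_mono mult_left_mono) auto
  also have "\<dots> = ?M (E \<inter> G) + ennreal (mix n) * ?M E * ?M G"
    by (simp add: algebra_simps nn_integral_add EG)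
       (simp add: nn_integral_multc nn_integral_cmult E MG algebra_simps)
  finally have lower: "?M E * ?M G \<le> ?M (E \<inter> G) + ennreal (mix n) * ?M E * ?M G" .
  show ?thesis
    using upper lower mix_nonneg[of n]
    by (simp add: emeasure_eq_measure ennreal_mult[symmetric] ennreal_plus[symmetric] mult.assoc abs_le_iff del: ennreal_plus)
qed

lemma mix_antimono: "antimono_on {1..} mix"
proof (rule monotone_onI)
  fix x y :: nat assume "x \<le> y"
  then have "(x - 1) div k \<le> (y - 1) div k" by (intro div_le_mono diff_le_mono)
  then show "mix y \<le> mix x"
    using rate K_ge_1 unfolding mix_def by (intro mult_left_mono power_decreasing) auto
qed

lemma mix_tendsto: "mix \<longlonglongrightarrow> 0"
proof -
  have "filterlim (\<lambda>n. (n - 1) div k) at_top sequentially"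
    unfolding filterlim_at_top
  proof
    fix Z
    have "Z \<le> (n - 1) div k" if "n \<ge> Z * k + 1" for n
      using that k_pos by (simp add: less_eq_div_iff_mult_less_eq)
    then show "\<forall>\<^sub>F n in sequentially. Z \<le> (n - 1) div k"
      by (auto simp: eventually_sequentially)
  qed
  then have "(\<lambda>n. rate ^ ((n - 1) div k)) \<longlonglongrightarrow> 0"
    using rate by (intro filterlim_compose[OF LIMSEQ_power_zero]) auto
  from tendsto_mult_left[OF this, of K] show ?thesis
    by (simp add: mix_def[abs_def])
qed

lemma past_event:
  assumes "E \<in> generated_sigma (law []) digit_process {1..m}"
  shows "\<exists>U. E = {\<omega>. prefix_of m \<omega> \<in> U}"
  using assms unfolding generated_sigma_def
proof (induction rule: sigma_sets.induct)
  case (Basic a)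
  then obtain i B where i: "i \<in> {1..m}" and a: "a = digit_process i -` B \<inter> space (law [])" by auto
  have "a = {\<omega>. prefix_of m \<omega> \<in> {v. Suc (v ! (i - 1)) \<in> B}}"
    using i unfolding a by (auto simp: digit_process_def)
  then show ?case by blast
next
  case Empty
  then show ?case by (intro exI[of _ "{}"]) simp
next
  case (Compl a)
  then obtain U where "a = {\<omega>. prefix_of m \<omega> \<in> U}" by blast
  then have "space (law []) - a = {\<omega>. prefix_of m \<omega> \<in> - U}" by auto
  then show ?case by blast
next
  case (Union a)
  then obtain U where "\<And>i. a i = {\<omega>. prefix_of m \<omega> \<in> U i}" by metis
  then have "(\<Union>i. a i) = {\<omega>. prefix_of m \<omega> \<in> (\<Union>i. U i)}" by auto
  then show ?case by blast
qed

lemma future_event: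
  assumes "G \<in> generated_sigma (law []) digit_process {Suc m..}"
  shows "\<exists>F\<in>sets seq_space. G = shift_seq m -` F"
  using assms unfolding generated_sigma_def
proof (induction rule: sigma_sets.induct)
  case (Basic a)
  then obtain i B where i: "Suc m \<le> i" and a: "a = digit_process i -` B \<inter> space (law [])" by auto
  have "a = shift_seq m -` ((\<lambda>\<omega>. Suc (\<omega> (i - 1 - m))) -` B)"
    using i unfolding a by (auto simp: digit_process_def shift_seq_def)
  moreover have "(\<lambda>\<omega>. \<omega> (i - 1 - m)) -` (Suc -` B) \<inter> space seq_space \<in> sets seq_space"
    by (rule measurable_sets[OF measurable_coord]) simp
  ultimately show ?case by (auto simp: vimage_def)
next
  case Empty
  then show ?case by (intro bexI[of _ "{}"]) auto
next
  case (Compl a)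
  then obtain F where "F \<in> sets seq_space" "a = shift_seq m -` F" by blast
  moreover have "space seq_space - F \<in> sets seq_space" using \<open>F \<in> sets seq_space\<close> by (rule sets.compl_sets)
  ultimately show ?case by (intro bexI[of _ "space seq_space - F"]) auto
next
  case (Union a)
  then obtain F where F: "\<And>i. F i \<in> sets seq_space" "\<And>i. a i = shift_seq m -` F i" by metis
  then have "(\<Union>i. F i) \<in> sets seq_space" by auto
  then show ?case by (intro bexI[of _ "\<Union>i. F i"]) (use F in auto)
qed

theorem psi_mixing_digits: "psi_mixing (law []) digit_process"
  unfolding psi_mixing_def
proof (intro exI[of _ mix] conjI allI impI ballI mix_antimono mix_tendsto)
  fix n m E G
  assume n: "1 \<le> (n::nat)" and "1 \<le> (m::nat)"
    and E: "E \<in> generated_sigma (law []) digit_process {1..m}"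
    and G: "G \<in> generated_sigma (law []) digit_process {m + n..}"
  obtain U where "E = {\<omega>. prefix_of m \<omega> \<in> U}"
    using past_event[OF E] by blast
  moreover obtain F where "F \<in> sets seq_space" "G = shift_seq (m + n - 1) -` F"
    using future_event[of G "m + n - 1"] G n by auto
  ultimately show "\<bar>measure (law []) (E \<inter> G) - measure (law []) E * measure (law []) G\<bar>
      \<le> mix n * measure (law []) E * measure (law []) G"
    using joint_mixing[OF _ n] by blast
qed

theorem positive_digits: "positive_nat_process (law []) digit_process"
  unfolding positive_nat_process_def digit_process_def
  by (auto intro!: measurable_compose[OF measurable_coord] simp: measurable_cong_sets[OF sets_law refl])

theorem stationary_digits: "stationary_process (law []) digit_process"
  unfolding stationary_process_def
proof
  fix h
  let ?S = "\<lambda>\<omega> i. Suc (\<omega> i) :: nat"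
  have S: "?S \<in> seq_space \<rightarrow>\<^sub>M seq_space"
    by (rule measurable_PiM_single') (auto intro: measurable_compose[OF measurable_coord])
  have "(\<lambda>\<omega> i. digit_process (Suc i + h) \<omega>) = ?S \<circ> shift_seq h"
    by (auto simp: digit_process_def shift_seq_def fun_eq_iff)
  then have "distr (law []) seq_space (\<lambda>\<omega> i. digit_process (Suc i + h) \<omega>) =
     distr (distr (law []) seq_space (shift_seq h)) seq_space ?S"
    using S by (simp add: distr_distr)
  also have "\<dots> = distr (law []) seq_space (\<lambda>\<omega> i. digit_process (Suc i) \<omega>)"
    by (simp add: stationary digit_process_def)
  finally show "distr (law []) seq_space (\<lambda>\<omega> i. digit_process (Suc i + h) \<omega>) =
      distr (law []) seq_space (\<lambda>\<omega> i. digit_process (Suc i) \<omega>)" .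
qed

lemma measure_cyl: "measure (law []) (cyl w) = W w"
  using law_cyl[of "[]" w] W_nonneg[of w] by (simp add: measure_def)

lemma measure_shift_cyl: "measure (law []) (shift_seq n -` cyl w) = W w"
  using law_shift[of "cyl w" n] measure_cyl[of w] by (simp add: measure_def)

theorem markov_digits: "markov_chain_step (law []) k digit_process"
  unfolding markov_chain_step_def
proof (intro allI impI)
  fix n :: nat and a :: "nat \<Rightarrow> nat" and b :: nat
  let ?M = "law []"
  assume n: "k \<le> n" and pos: "0 < \<P>(\<omega> in ?M. \<forall>i\<in>{1..n}. digit_process i \<omega> = a i)"
  have a: "1 \<le> a i" if "i \<in> {1..n}" for i
  proof (rule ccontr)
    assume "\<not> 1 \<le> a i"
    then have "{\<omega> \<in> space ?M. \<forall>i\<in>{1..n}. digit_process i \<omega> = a i} = {}"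
      using that by (auto simp: digit_process_def intro!: bexI[of _ i])
    then show False using pos by (metis measure_empty order_less_irrefl)
  qed
  define u v where "u = map (\<lambda>i. a (Suc i) - 1) [0..<n - k]" and "v = map (\<lambda>i. a (Suc i) - 1) [n - k..<n]"
  have len: "length u = n - k" "length v = k" using n by (auto simp: u_def v_def)
  have past: "(\<forall>i\<in>{n - k + 1..n}. digit_process i \<omega> = a i) \<longleftrightarrow> shift_seq (n - k) \<omega> \<in> cyl v" for \<omega>
  proof -
    have "(\<forall>i\<in>{n - k + 1..n}. digit_process i \<omega> = a i) \<longleftrightarrow> (\<forall>i<k. digit_process (Suc (i + (n - k))) \<omega> = a (Suc (i + (n - k))))"
    proof (intro iffI ballI allI impI)
      fix i assume *: "\<forall>i<k. digit_process (Suc (i + (n - k))) \<omega> = a (Suc (i + (n - k)))" "i \<in> {n - k + 1..n}"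
      define j where "j = i - 1 - (n - k)"
      have "i = Suc (j + (n - k))" "j < k" using *(2) n by (auto simp: j_def)
      then show "digit_process i \<omega> = a i"
        using *(1) by blast
    next
      fix i assume *: "\<forall>i\<in>{n - k + 1..n}. digit_process i \<omega> = a i" "i < k"
      moreover have "Suc (i + (n - k)) \<in> {n - k + 1..n}" using *(2) n by auto
      ultimately show "digit_process (Suc (i + (n - k))) \<omega> = a (Suc (i + (n - k)))" by blast
    qed
    also have "\<dots> \<longleftrightarrow> (\<forall>i<k. \<omega> (i + (n - k)) = a (Suc (i + (n - k))) - 1)"
    proof (intro all_cong)
      fix i assume "i < k"
      then have "1 \<le> a (Suc (i + (n - k)))" using n by (intro a) auto
      then show "digit_process (Suc (i + (n - k))) \<omega> = a (Suc (i + (n - k))) \<longleftrightarrow> \<omega> (i + (n - k)) = a (Suc (i + (n - k))) - 1"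
        by (auto simp: digit_process_def)
    qed
    also have "\<dots> \<longleftrightarrow> shift_seq (n - k) \<omega> \<in> cyl v"
      using n by (auto simp: cyl_iff shift_seq_def v_def add.commute)
    finally show ?thesis .
  qed
  have uv: "u @ v = map (\<lambda>i. a (Suc i) - 1) [0..<n]"
    unfolding u_def v_def map_append[symmetric] using n upt_add_eq_append[of 0 "n - k" k] by simp
  have full: "(\<forall>i\<in>{1..n}. digit_process i \<omega> = a i) \<longleftrightarrow> \<omega> \<in> cyl (u @ v)" for \<omega>
  proof -
    have "(\<forall>i\<in>{1..n}. digit_process i \<omega> = a i) \<longleftrightarrow> (\<forall>i<n. digit_process (Suc i) \<omega> = a (Suc i))"
    proof (intro iffI ballI allI impI)
      fix i assume *: "\<forall>i<n. digit_process (Suc i) \<omega> = a (Suc i)" "i \<in> {1..n}"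
      then show "digit_process i \<omega> = a i"
        using *(1)[rule_format, of "i - 1"] by auto
    qed auto
    also have "\<dots> \<longleftrightarrow> (\<forall>i<n. \<omega> i = a (Suc i) - 1)"
    proof (intro all_cong)
      fix i assume "i < n"
      then have "1 \<le> a (Suc i)" by (intro a) auto
      then show "digit_process (Suc i) \<omega> = a (Suc i) \<longleftrightarrow> \<omega> i = a (Suc i) - 1"
        by (auto simp: digit_process_def)
    qed
    also have "\<dots> \<longleftrightarrow> \<omega> \<in> cyl (u @ v)" by (auto simp: uv cyl_iff)
    finally show ?thesis .
  qed
  show "\<P>(\<omega> in ?M. digit_process (n + 1) \<omega> = b \<bar> \<forall>i\<in>{1..n}. digit_process i \<omega> = a i) =
        \<P>(\<omega> in ?M. digit_process (n + 1) \<omega> = b \<bar> \<forall>i\<in>{n - k + 1..n}. digit_process i \<omega> = a i)"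
  proof (cases b)
    case 0
    then show ?thesis by (simp add: cond_prob_def digit_process_def)
  next
    case (Suc b')
    have next1: "{\<omega>. digit_process (n + 1) \<omega> = b \<and> \<omega> \<in> cyl (u @ v)} = cyl ((u @ v) @ [b'])"
      unfolding cyl_append_eq[of "u @ v" "[b']"] using len n Suc
      by (auto simp: digit_process_def cyl_iff shift_seq_def)
    have next2: "{\<omega>. digit_process (n + 1) \<omega> = b \<and> shift_seq (n - k) \<omega> \<in> cyl v} = shift_seq (n - k) -` cyl (v @ [b'])"
      unfolding cyl_append_eq[of v "[b']"] using len n Suc
      by (auto simp: digit_process_def cyl_iff shift_seq_def)
    have "W (u @ v @ [b']) / W (u @ v) = W (v @ [b']) / W v"
      using W_markov[OF len(2), of u "[b']"] W_pos[of v] W_pos[of "u @ v"]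
      by (simp add: frac_eq_eq mult.commute)
    then show ?thesis
      unfolding cond_prob_def full past space_law using next1 next2
      by (simp add: measure_cyl measure_shift_cyl measure_shift_cyl[unfolded vimage_def])
  qed
qed

end

section \<open>Geometry of continued fraction cylinders\<close>

primrec cf_map :: "nat list \<Rightarrow> real \<Rightarrow> real" where
  "cf_map [] y = y"
| "cf_map (b # w) y = 1 / (1 + real b + cf_map w y)"

lemma cf_map_append: "cf_map (v @ w) y = cf_map v (cf_map w y)"
  by (induction v) auto

lemma cf_map_nonneg: "0 \<le> y \<Longrightarrow> 0 \<le> cf_map w y"
  by (induction w) auto

lemma cf_map_le_1: "0 \<le> y \<Longrightarrow> y \<le> 1 \<Longrightarrow> cf_map w y \<le> 1"
proof (cases w)
  case (Cons b v)
  have "0 \<le> cf_map v y" if "0 \<le> y" using that by (rule cf_map_nonneg)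
  then show "0 \<le> y \<Longrightarrow> cf_map w y \<le> 1" by (simp add: Cons divide_le_eq_1)
qed simp

text \<open>Each letter reverses the order, so the direction depends on the parity of the length.\<close>

lemma cf_map_monotone:
  "mono_on {0..} (cf_map w) \<or> antimono_on {0..} (cf_map w)"
proof (induction w)
  case (Cons b w)
  have "1 / (1 + real b + s) \<le> 1 / (1 + real b + t)" if "0 \<le> t" "t \<le> s" for s t
    using that by (intro divide_left_mono) auto
  then show ?case
    using Cons by (auto simp: monotone_on_def cf_map_nonneg)
qed (simp add: monotone_on_def)

text \<open>The map is the Moebius transformation \<open>y \<mapsto> (p + p' y) / (q + r y)\<close> of determinant \<open>\<plusminus>1\<close>, where \<open>q\<close> and \<open>r\<close> are
  the last two continuant denominators; hence the formula. Appending a letter \<open>a\<close> replaces \<open>(q, r)\<close> by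
  \<open>((a + 1) q + r, q)\<close>, which preserves \<open>r \<le> q\<close> and at least doubles \<open>q (q + r)\<close>.\<close>

lemma cf_map_diff:
  obtains q r where "1 \<le> q" "0 \<le> r" "r \<le> q" "2 ^ length w \<le> q * (q + r)"
    "\<And>x y. \<lbrakk>0 \<le> x; 0 \<le> y\<rbrakk> \<Longrightarrow>
       \<bar>cf_map w x - cf_map w y\<bar> = \<bar>x - y\<bar> / ((q + x * r) * (q + y * r))"
proof -
  have "\<exists>q r. 1 \<le> q \<and> 0 \<le> r \<and> r \<le> q \<and> 2 ^ length w \<le> q * (q + r) \<and>
    (\<forall>x\<ge>0. \<forall>y\<ge>0. \<bar>cf_map w x - cf_map w y\<bar> = \<bar>x - y\<bar> / ((q + x * r) * (q + y * r)))"
  proof (induction w rule: rev_induct)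
    case Nil
    show ?case by (rule exI[of _ 1], rule exI[of _ 0]) auto
  next
    case (snoc a w)
    then obtain q r where q: "1 \<le> q" "0 \<le> r" "r \<le> q" "2 ^ length w \<le> q * (q + r)"
      and diff: "\<And>x y. \<lbrakk>0 \<le> x; 0 \<le> y\<rbrakk> \<Longrightarrow>
         \<bar>cf_map w x - cf_map w y\<bar> = \<bar>x - y\<bar> / ((q + x * r) * (q + y * r))" by blast
    define A where "A = 1 + real a"
    have A: "1 \<le> A" by (simp add: A_def)
    have q': "q \<le> A * q" using A q by simp
    have "2 * (q * (q + r)) \<le> (q + r) * (q + r + q)"
      using q by (simp add: algebra_simps)
    also have "\<dots> \<le> (A * q + r) * (A * q + r + q)"
      using q q' by (intro mult_mono) auto
    finally have "2 ^ length (w @ [a]) \<le> (A * q + r) * (A * q + r + q)"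
      using q(4) by simp
    moreover have "\<bar>cf_map (w @ [a]) x - cf_map (w @ [a]) y\<bar> = \<bar>x - y\<bar> / ((A * q + r + x * q) * (A * q + r + y * q))"
      if xy: "0 \<le> x" "0 \<le> y" for x y
    proof -
      have pos: "0 < A + x" "0 < A + y" using A xy by auto
      have "\<bar>cf_map (w @ [a]) x - cf_map (w @ [a]) y\<bar> = \<bar>1 / (A + x) - 1 / (A + y)\<bar> / ((q + 1 / (A + x) * r) * (q + 1 / (A + y) * r))"
        using pos by (simp add: cf_map_append A_def diff)
      also have "1 / (A + x) - 1 / (A + y) = (y - x) / ((A + x) * (A + y))"
        using pos by (simp add: field_simps)
      also have "\<bar>(y - x) / ((A + x) * (A + y))\<bar> = \<bar>x - y\<bar> / ((A + x) * (A + y))"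
        using pos by (simp add: abs_mult abs_minus_commute)
      also have "q + 1 / (A + x) * r = (A * q + r + x * q) / (A + x)"
        using pos by (simp add: field_simps)
      also have "q + 1 / (A + y) * r = (A * q + r + y * q) / (A + y)"
        using pos by (simp add: field_simps)
      finally show ?thesis using pos by simp
    qed
    moreover have "1 \<le> A * q + r" "q \<le> A * q + r" using q q' by linarith+
    ultimately show ?case
      using q by - (rule exI[of _ "A * q + r"], rule exI[of _ q], auto)
  qed
  then show ?thesis using that by blast
qed

lemma cf_map_lipschitz:
  assumes "0 \<le> x" "0 \<le> y"
  shows "\<bar>cf_map w x - cf_map w y\<bar> \<le> \<bar>x - y\<bar>"
proof -
  obtain q r where q: "1 \<le> q" "0 \<le> r" 
    and diff: "\<bar>cf_map w x - cf_map w y\<bar> = \<bar>x - y\<bar> / ((q + x * r) * (q + y * r))"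
    using cf_map_diff[of w] assms by metis
  have "1 * 1 \<le> (q + x * r) * (q + y * r)"
    using q assms by (intro mult_mono) (auto intro: add_increasing2)
  then have "\<bar>x - y\<bar> / ((q + x * r) * (q + y * r)) \<le> \<bar>x - y\<bar> / 1"
    by (intro divide_left_mono) auto
  then show ?thesis unfolding diff by simp
qed

text \<open>The length of the interval of numbers whose expansion starts with \<open>w\<close>.\<close>

definition cf_len :: "nat list \<Rightarrow> real" where
  "cf_len w = \<bar>cf_map w 1 - cf_map w 0\<bar>"

lemma cf_len_pos: "0 < cf_len w"
proof -
  obtain q r where "1 \<le> q" "0 \<le> r" "cf_len w = 1 / (q * (q + r))"
    unfolding cf_len_def by (rule cf_map_diff[of w]) (simp add: mult.commute)
  then show ?thesis by simp
qed

lemma cf_len_le: "cf_len w \<le> 1 / 2 ^ length w"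
proof -
  obtain q r where q: "1 \<le> q" "0 \<le> r" "2 ^ length w \<le> q * (q + r)" "cf_len w = 1 / (q * (q + r))"
    unfolding cf_len_def by (rule cf_map_diff[of w]) (simp add: mult.commute)
  then have "1 / (q * (q + r)) \<le> 1 / 2 ^ length w"
    by (intro divide_left_mono) auto
  then show ?thesis using q by simp
qed

definition cf_lo :: "nat list \<Rightarrow> real" where "cf_lo w = min (cf_map w 0) (cf_map w 1)"
definition cf_hi :: "nat list \<Rightarrow> real" where "cf_hi w = max (cf_map w 0) (cf_map w 1)"

lemma cf_hi_minus_lo: "cf_hi w - cf_lo w = cf_len w"
  by (auto simp: cf_hi_def cf_lo_def cf_len_def)

lemma cf_lo_nonneg: "0 \<le> cf_lo w" and cf_hi_le_1: "cf_hi w \<le> 1"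
  by (auto simp: cf_lo_def cf_hi_def cf_map_nonneg cf_map_le_1)

lemma cf_map_between:
  assumes "0 \<le> y" "y \<le> 1"
  shows "cf_lo w \<le> cf_map w y" "cf_map w y \<le> cf_hi w"
  using cf_map_monotone[of w] assms
  by (auto simp: monotone_on_def cf_lo_def cf_hi_def min_le_iff_disj le_max_iff_disj)

lemma cf_lo_snoc: "cf_lo w \<le> cf_lo (w @ v)" and cf_hi_snoc: "cf_hi (w @ v) \<le> cf_hi w"
  using cf_map_between[OF cf_map_nonneg cf_map_le_1, of 0 w v] cf_map_between[OF cf_map_nonneg cf_map_le_1, of 1 w v]
  by (auto simp: cf_lo_def[of "w @ v"] cf_hi_def[of "w @ v"] cf_map_append)

section \<open>The Gauss measure of cylinders\<close>

text \<open>Up to the factor \<open>1 / ln 2\<close> this is the Gauss measure, with density \<open>1 / (1 + x)\<close>, of the cylinder of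
  \<open>w\<close>. Its invariance under the Gauss map is the left consistency proved below.\<close>

definition gauss :: "nat list \<Rightarrow> real" where
  "gauss w = \<bar>ln (1 + cf_map w 1) - ln (1 + cf_map w 0)\<bar>"

lemma gauss_eq: "gauss w = ln (1 + cf_hi w) - ln (1 + cf_lo w)"
  using cf_map_nonneg[of 0 w] cf_map_nonneg[of 1 w]
  by (auto simp: gauss_def cf_hi_def cf_lo_def min_def max_def)

lemma gauss_bounds: "cf_len w / (1 + cf_hi w) \<le> gauss w" "gauss w \<le> cf_len w / (1 + cf_lo w)"
proof -
  have lo: "0 \<le> cf_lo w" by (rule cf_lo_nonneg)
  have lt: "1 + cf_lo w < 1 + cf_hi w" using cf_hi_minus_lo[of w] cf_len_pos[of w] by simp
  obtain z where z: "1 + cf_lo w < z" "z < 1 + cf_hi w"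
    "ln (1 + cf_hi w) - ln (1 + cf_lo w) = (1 + cf_hi w - (1 + cf_lo w)) * (1 / z)"
  proof -
    have "(ln has_real_derivative 1 / z) (at z)" if "1 + cf_lo w \<le> z" for z
      using that lo by (intro DERIV_ln_divide) auto
    from MVT2[OF lt, of ln "\<lambda>z. 1 / z"] this show ?thesis using that by blast
  qed
  then have g: "gauss w = cf_len w / z"
    by (simp add: gauss_eq flip: cf_hi_minus_lo)
  show "cf_len w / (1 + cf_hi w) \<le> gauss w" "gauss w \<le> cf_len w / (1 + cf_lo w)"
    unfolding g using z lo cf_len_pos[of w] by (auto intro!: divide_left_mono mult_pos_pos)
qed

lemma gauss_pos: "0 < gauss w"
proof -
  have "0 < cf_len w / (1 + cf_hi w)"
    using cf_len_pos[of w] cf_hi_minus_lo[of w] cf_lo_nonneg[of w] by simp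
  then show ?thesis using gauss_bounds(1)[of w] by simp
qed

lemma gauss_le_len: "gauss w \<le> cf_len w"
proof -
  have "cf_len w / (1 + cf_lo w) \<le> cf_len w / 1"
    using cf_lo_nonneg[of w] cf_len_pos[of w] by (intro divide_left_mono) auto
  then show ?thesis using gauss_bounds(2)[of w] by simp
qed

lemma len_le_gauss: "cf_len w \<le> 2 * gauss w"
proof -
  have "cf_len w / 2 \<le> cf_len w / (1 + cf_hi w)"
    using cf_lo_nonneg[of w] cf_hi_le_1[of w] cf_hi_minus_lo[of w] cf_len_pos[of w] by (intro divide_left_mono) auto
  then show ?thesis using gauss_bounds(1)[of w] by linarith
qed

text \<open>The endpoints of the subintervals are the images of \<open>1, 1/2, 1/3, \<dots>\<close>, so the sum telescopes.\<close>

lemma gauss_right: "(\<lambda>a. gauss (w @ [a])) sums gauss w"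
proof -
  define f where "f n = ln (1 + cf_map w (1 / (1 + real n)))" for n :: nat
  have pos: "0 < 1 + cf_map w y" if "0 \<le> y" for y using cf_map_nonneg[OF that, of w] by simp
  have "(\<lambda>n. cf_map w (1 / (1 + real n)) - cf_map w 0) \<longlonglongrightarrow> 0"
  proof (rule tendsto_rabs_zero_cancel, rule tendsto_sandwich[where f = "\<lambda>_. 0" and h = "\<lambda>n. 1 / (1 + real n)"])
    show "(\<lambda>n. 1 / (1 + real n)) \<longlonglongrightarrow> 0"
      using LIMSEQ_inverse_real_of_nat by (simp add: inverse_eq_divide add.commute)
    show "\<forall>\<^sub>F n in sequentially. \<bar>cf_map w (1 / (1 + real n)) - cf_map w 0\<bar> \<le> 1 / (1 + real n)"
      using cf_map_lipschitz[of "1 / (1 + real n)" 0 w for n] by (simp add: field_simps)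
  qed auto
  then have "(\<lambda>n. cf_map w (1 / (1 + real n))) \<longlonglongrightarrow> cf_map w 0"
    by (simp add: Lim_null[symmetric])
  then have lim: "f \<longlonglongrightarrow> ln (1 + cf_map w 0)"
    unfolding f_def using pos[of 0] by (intro tendsto_intros) auto
  have sums: "(\<lambda>n. f n - f (Suc n)) sums (f 0 - ln (1 + cf_map w 0))"
    by (rule telescope_sums'[OF lim])
  have g: "gauss (w @ [a]) = \<bar>f a - f (Suc a)\<bar>" for a
    by (simp add: gauss_def cf_map_append f_def abs_minus_commute add_ac)
  have gw: "gauss w = \<bar>f 0 - ln (1 + cf_map w 0)\<bar>"
    by (simp add: gauss_def f_def)
  have ord: "0 \<le> 1 / (1 + real (Suc a))" "1 / (1 + real (Suc a)) \<le> 1 / (1 + real a)" for a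
    by (auto simp: frac_le)
  show ?thesis
    using cf_map_monotone[of w]
  proof
    assume m: "mono_on {0..} (cf_map w)"
    have "f (Suc a) \<le> f a" for a
      unfolding f_def using ord[of a] pos m by (auto simp: monotone_on_def)
    moreover have "ln (1 + cf_map w 0) \<le> f 0"
      unfolding f_def using pos m by (auto simp: monotone_on_def)
    ultimately show ?thesis using sums by (simp add: g gw)
  next
    assume m: "antimono_on {0..} (cf_map w)"
    have "f a \<le> f (Suc a)" for a
      unfolding f_def using ord[of a] pos m by (auto simp: monotone_on_def)
    moreover have "f 0 \<le> ln (1 + cf_map w 0)"
      unfolding f_def using pos m by (auto simp: monotone_on_def)
    ultimately show ?thesis using sums_minus[OF sums] by (simp add: g gw)
  qed
qed

text \<open>The preimages of an interval \<open>(x, y)\<close> under the Gauss map have endpoints \<open>1 / (n + x)\<close> and \<open>1 / (n + y)\<close>.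
  Since \<open>1 + 1 / (n + t) = (n + 1 + t) / (n + t)\<close>, the sum of their Gauss measures telescopes.\<close>

lemma gauss_left: "(\<lambda>b. gauss (b # w)) sums gauss w"
proof -
  define x y where "x = cf_lo w" and "y = cf_hi w"
  have xy: "0 \<le> x" "x \<le> y"
    using cf_lo_nonneg[of w] cf_hi_minus_lo[of w] cf_len_pos[of w] by (auto simp: x_def y_def)
  define h where "h n = ln (1 + (y - x) / (1 + real n + x))" for n :: nat
  have h_eq: "h n = ln (1 + real n + y) - ln (1 + real n + x)" for n
  proof -
    have "1 + (y - x) / (1 + real n + x) = (1 + real n + y) / (1 + real n + x)"
      using xy by (simp add: field_simps)
    then show ?thesis using xy by (simp add: h_def ln_div)
  qed
  have "(\<lambda>n. (y - x) / (1 + real n + x)) \<longlonglongrightarrow> 0"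
  proof (rule tendsto_sandwich[where f = "\<lambda>_. 0" and h = "\<lambda>n. (y - x) * inverse (real (Suc n))"])
    show "(\<lambda>n. (y - x) * inverse (real (Suc n))) \<longlonglongrightarrow> 0"
      by (intro tendsto_mult_right_zero LIMSEQ_inverse_real_of_nat)
    show "\<forall>\<^sub>F n in sequentially. (y - x) / (1 + real n + x) \<le> (y - x) * inverse (real (Suc n))"
      using xy by (intro always_eventually allI) (auto simp: inverse_eq_divide intro!: divide_left_mono)
  qed (use xy in auto)
  then have "(\<lambda>n. 1 + (y - x) / (1 + real n + x)) \<longlonglongrightarrow> 1 + 0"
    by (intro tendsto_intros)
  then have "h \<longlonglongrightarrow> ln (1 + 0)"
    unfolding h_def by (intro tendsto_ln) auto
  then have sums: "(\<lambda>n. h n - h (Suc n)) sums (h 0 - 0)"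
    by (intro telescope_sums') simp
  have dec: "h (Suc n) \<le> h n" for n
  proof -
    have "(y - x) / (1 + real (Suc n) + x) \<le> (y - x) / (1 + real n + x)"
      using xy by (intro divide_left_mono) auto
    then show ?thesis unfolding h_def using xy
      by (subst ln_le_cancel_iff) (auto intro: add_pos_nonneg)
  qed
  have ln1: "ln (1 + 1 / (1 + real b + t)) = ln (1 + real (Suc b) + t) - ln (1 + real b + t)" if "0 \<le> t" for b t
  proof -
    have "1 + 1 / (1 + real b + t) = (1 + real (Suc b) + t) / (1 + real b + t)"
      using that by (simp add: field_simps)
    then show ?thesis using that by (simp add: ln_div)
  qed
  have "gauss (b # w) = \<bar>h (Suc b) - h b\<bar>" for b
    using cf_map_nonneg[of 0 w] cf_map_nonneg[of 1 w]
    by (auto simp: gauss_def ln1 h_eq x_def y_def cf_lo_def cf_hi_def min_def max_def abs_minus_commute)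
  then have "gauss (b # w) = h b - h (Suc b)" for b
    using dec[of b] by simp
  moreover have "gauss w = h 0 - 0"
    by (simp add: gauss_eq h_eq x_def y_def)
  ultimately show ?thesis using sums by simp
qed

lemma len_ratio:
  shows "(1 + real a) * (2 + real a) * cf_len (w @ [a]) \<le> 2 * cf_len w"
    and "cf_len w \<le> 4 * ((1 + real a) * (2 + real a) * cf_len (w @ [a]))"
proof -
  obtain q r where q: "1 \<le> q" "0 \<le> r" "r \<le> q"
    and diff: "\<And>x y. \<lbrakk>0 \<le> x; 0 \<le> y\<rbrakk> \<Longrightarrow>
         \<bar>cf_map w x - cf_map w y\<bar> = \<bar>x - y\<bar> / ((q + x * r) * (q + y * r))"
    using cf_map_diff[of w] by metis
  define A where "A = 1 + real a"
  have A: "1 \<le> A" by (simp add: A_def)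
  let ?D = "(q + 1 / (A + 1) * r) * (q + 1 / A * r)"
  have len: "cf_len w = 1 / ((q + r) * q)"
    unfolding cf_len_def by (subst diff) auto
  have "\<bar>1 / (A + 1) - 1 / A\<bar> = 1 / (A * (A + 1))"
    using A by (simp add: field_simps)
  then have "cf_len (w @ [a]) = 1 / (A * (A + 1)) / ?D"
    unfolding cf_len_def cf_map_append using A by (simp add: diff A_def add_ac)
  then have len': "(1 + real a) * (2 + real a) * cf_len (w @ [a]) = 1 / ?D"
    using A by (simp add: A_def add_ac)
  have r: "0 \<le> 1 / (A + 1) * r" "1 / (A + 1) * r \<le> q" "0 \<le> 1 / A * r" "1 / A * r \<le> q"
    using A q mult_right_mono[of "1 / (A + 1)" 1 r] mult_right_mono[of "1 / A" 1 r] by auto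
  have D: "q * q \<le> ?D"
    by (rule mult_mono) (use q r in auto)
  have D': "?D \<le> (2 * q) * (2 * q)"
    by (rule mult_mono) (use q r in auto)
  have qq: "1 \<le> q * q" using q mult_mono[of 1 q 1 q] by simp
  have E: "q * q \<le> (q + r) * q" "(q + r) * q \<le> 2 * (q * q)" using q by (auto simp: algebra_simps)
  have "1 / ?D \<le> 1 / (q * q)" using D qq by (intro divide_left_mono) auto
  also have "\<dots> = 2 / (2 * (q * q))" by simp
  also have "\<dots> \<le> 2 / ((q + r) * q)" using E qq by (intro divide_left_mono) auto
  finally show "(1 + real a) * (2 + real a) * cf_len (w @ [a]) \<le> 2 * cf_len w"
    by (simp add: len len')
  have "1 / ((q + r) * q) \<le> 1 / (q * q)" using E qq by (intro divide_left_mono) auto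
  also have "\<dots> = 4 / ((2 * q) * (2 * q))" by simp
  also have "\<dots> \<le> 4 / ?D" using D D' qq by (intro divide_left_mono) auto
  finally show "cf_len w \<le> 4 * ((1 + real a) * (2 + real a) * cf_len (w @ [a]))"
    by (simp add: len len')
qed

text \<open>The conditional Gauss probability of a letter \<open>a\<close> after any word lies between \<open>1/8\<close> and \<open>4\<close> times
  \<open>1 / ((a + 1) (a + 2))\<close>: the length ratio contributes the factors \<open>1/4\<close> and \<open>2\<close>, the density a factor
  \<open>2\<close> either way.\<close>

lemma gauss_ratio: "gauss (w @ [a]) * gauss w' \<le> 32 * (gauss (w' @ [a]) * gauss w)"
proof -
  define m where "m = (1 + real a) * (2 + real a)"
  have m: "0 < m" by (simp add: m_def)
  have "m * gauss (w @ [a]) \<le> 4 * gauss w"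
    using len_ratio(1)[of a w] gauss_le_len[of "w @ [a]"] len_le_gauss[of w] mult_left_mono[of "gauss (w @ [a])" "cf_len (w @ [a])" m] m
    unfolding m_def[symmetric] by linarith
  moreover have "gauss w' \<le> 8 * (m * gauss (w' @ [a]))"
    using len_ratio(2)[of w' a] gauss_le_len[of "w'"] mult_left_mono[OF len_le_gauss[of "w' @ [a]"], of m] m
    unfolding m_def[symmetric] by linarith
  ultimately have *: "m * gauss (w @ [a]) * gauss w' \<le> 4 * gauss w * (8 * (m * gauss (w' @ [a])))"
    using gauss_pos[of w] gauss_pos[of w'] by - (rule mult_mono, simp_all)
  then have "m * (gauss (w @ [a]) * gauss w') \<le> m * (32 * (gauss (w' @ [a]) * gauss w))"
    by (simp add: ac_simps)
  then show ?thesis using m by simp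
qed

text \<open>The conditional probability of the next letter under the Gauss measure given \<open>w\<close>, compared with that under
  Lebesgue measure given the longer past \<open>u @ w\<close>. Lebesgue measure on the cylinder of \<open>u\<close>, pulled back to the
  unit interval, has density proportional to \<open>1 / (q + r x)\<^sup>2\<close> with \<open>r \<le> q\<close>. This density and \<open>1 / (1 + x)\<close> vary
  slowly, and only their variation over the short cylinder of \<open>w\<close> matters: it costs one factor
  \<open>1 + cf_len w\<close> for each of them.\<close>

lemma gauss_distortion:
  "gauss (w @ [a]) * cf_len (u @ w) \<le> (1 + cf_len w)\<^sup>2 * gauss w * cf_len (u @ w @ [a])"
proof -
  obtain q r where q: "1 \<le> q" "0 \<le> r" "r \<le> q"
    and diff: "\<And>x y. \<lbrakk>0 \<le> x; 0 \<le> y\<rbrakk> \<Longrightarrow>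
         \<bar>cf_map u x - cf_map u y\<bar> = \<bar>x - y\<bar> / ((q + x * r) * (q + y * r))"
    using cf_map_diff[of u] by metis
  let ?s = "\<lambda>x. q + x * r"
  let ?v = "w @ [a]"
  have s_mono: "?s x \<le> ?s y" if "x \<le> y" for x y using that q by (simp add: mult_right_mono)
  have s_pos: "0 < ?s x" if "0 \<le> x" for x using that q by (simp add: add_pos_nonneg)
  have len_u: "cf_len (u @ v) = cf_len v / (?s (cf_lo v) * ?s (cf_hi v))" for v
    using diff[of "cf_map v 1" "cf_map v 0"]
    by (auto simp: cf_len_def cf_map_append cf_map_nonneg cf_lo_def cf_hi_def min_def max_def mult.commute)
  have lo: "0 \<le> cf_lo w" "cf_lo w \<le> cf_lo ?v" and hi: "cf_hi ?v \<le> cf_hi w"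
    using cf_lo_nonneg cf_lo_snoc cf_hi_snoc by auto
  have lh: "cf_lo v \<le> cf_hi v" for v by (simp add: cf_lo_def cf_hi_def)
  have sv: "?s (cf_lo ?v) * ?s (cf_hi ?v) \<le> ?s (cf_hi w) * ?s (cf_hi w)"
    using s_mono s_pos lo hi lh[of ?v] by (intro mult_mono) (auto intro!: less_imp_le)
  have "cf_len w * r \<le> cf_len w * ?s (cf_lo w)"
    using q lo cf_len_pos[of w] by (intro mult_left_mono) (auto intro: add_increasing2)
  then have s1: "?s (cf_hi w) \<le> (1 + cf_len w) * ?s (cf_lo w)"
    by (simp add: algebra_simps flip: cf_hi_minus_lo)
  have "1 * cf_len w \<le> (1 + cf_lo w) * cf_len w"
    using lo cf_len_pos[of w] by (intro mult_right_mono) auto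
  then have h1: "1 + cf_hi w \<le> (1 + cf_len w) * (1 + cf_lo w)"
    using cf_hi_minus_lo[of w] by (simp add: algebra_simps)
  define S where "S = ?s (cf_lo w) * ?s (cf_hi w)"
  define T where "T = ?s (cf_lo ?v) * ?s (cf_hi ?v)"
  have S: "0 < S" and T: "0 < T"
    unfolding S_def T_def using s_pos lo lh[of w] lh[of ?v] by (auto intro!: mult_pos_pos)
  have "T \<le> ?s (cf_hi w) * ?s (cf_hi w)" using sv by (simp add: T_def)
  also have "\<dots> \<le> (1 + cf_len w) * ?s (cf_lo w) * ?s (cf_hi w)"
    using s1 s_pos[of "cf_hi w"] lo lh[of w] by (intro mult_right_mono) auto
  finally have TS: "T \<le> (1 + cf_len w) * S" by (simp add: S_def mult.assoc)
  have "gauss ?v \<le> cf_len ?v / (1 + cf_lo w)"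
    using gauss_bounds(2)[of ?v] lo cf_len_pos[of ?v]
    by (elim order_trans) (intro divide_left_mono, auto)
  also have "\<dots> \<le> cf_len ?v * (1 + cf_len w) / (1 + cf_hi w)"
  proof -
    have "1 / (1 + cf_lo w) \<le> (1 + cf_len w) / (1 + cf_hi w)"
      using h1 lo lh[of w] by (simp add: divide_simps)
    from mult_left_mono[OF this, of "cf_len ?v"] show ?thesis
      using cf_len_pos[of ?v] by simp
  qed
  finally have g1: "gauss ?v \<le> cf_len ?v * (1 + cf_len w) / (1 + cf_hi w)" .
  have "gauss ?v * cf_len w \<le> cf_len ?v * (1 + cf_len w) / (1 + cf_hi w) * cf_len w"
    using g1 cf_len_pos[of w] by (intro mult_right_mono) auto
  also have "\<dots> = cf_len ?v * (1 + cf_len w) * (cf_len w / (1 + cf_hi w))" by simp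
  also have "\<dots> \<le> cf_len ?v * (1 + cf_len w) * gauss w"
    using gauss_bounds(1)[of w] cf_len_pos[of ?v] cf_len_pos[of w] by (intro mult_left_mono) auto
  finally have g2: "gauss ?v * cf_len w \<le> cf_len ?v * (1 + cf_len w) * gauss w" .
  have "gauss ?v * cf_len (u @ w) = gauss ?v * cf_len w / S"
    by (simp add: len_u S_def)
  also have "\<dots> \<le> cf_len ?v * (1 + cf_len w) * gauss w / S"
    using g2 S by (intro divide_right_mono) auto
  also have "\<dots> \<le> cf_len ?v * (1 + cf_len w) * gauss w * ((1 + cf_len w) / T)"
  proof -
    have "1 / S \<le> (1 + cf_len w) / T" using TS S T by (simp add: field_simps)
    then have "cf_len ?v * (1 + cf_len w) * gauss w * (1 / S) \<le> cf_len ?v * (1 + cf_len w) * gauss w * ((1 + cf_len w) / T)"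
      using cf_len_pos[of ?v] cf_len_pos[of w] gauss_pos[of w] by (intro mult_left_mono) auto
    then show ?thesis by simp
  qed
  also have "\<dots> = (1 + cf_len w)\<^sup>2 * gauss w * cf_len (u @ ?v)"
    unfolding len_u[of ?v] T_def[symmetric] by (simp add: power2_eq_square)
  finally show ?thesis by simp
qed

section \<open>The Markov approximation of an invariant measure\<close>

text \<open>Weights \<open>G\<close> of a finite shift-invariant measure for which the conditional probabilities of a letter
  after two different pasts are comparable. The chain below remembers the last \<open>k\<close> letters and continues
  according to \<open>G\<close>. It has the same marginals of length \<open>k + 1\<close> as the normalised \<open>G\<close>, and it inherits
  stationarity from there, so that no invariant distribution has to be constructed.\<close>

locale invariant_weights =
  fixes G :: "nat list \<Rightarrow> real" and k :: nat and \<kappa> :: real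
  assumes k_pos: "0 < k"
    and G_pos: "\<And>w. 0 < G w"
    and G_right: "\<And>w. (\<lambda>a. G (w @ [a])) sums G w"
    and G_left: "\<And>w. (\<lambda>b. G (b # w)) sums G w"
    and G_ratio: "\<And>w w' a. G (w @ [a]) * G w' \<le> \<kappa> * (G (w' @ [a]) * G w)"
begin

text \<open>As subtraction of natural numbers truncates, a word shorter than \<open>k\<close> is its own recent past; so one
  formula gives both the initial distribution and the transitions of the chain.\<close>

definition recent :: "nat list \<Rightarrow> nat list" where
  "recent w = drop (length w - k) w"

definition step :: "nat list \<Rightarrow> nat \<Rightarrow> real" where
  "step w a = G (recent w @ [a]) / G (recent w)"

definition chain :: "nat list \<Rightarrow> real" where
  "chain w = (\<Prod>i<length w. step (take i w) (w ! i))"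

lemma chain_Nil: "chain [] = 1"
  by (simp add: chain_def)

lemma chain_snoc: "chain (w @ [a]) = chain w * step w a"
proof -
  have "(\<Prod>i<length w. step (take i (w @ [a])) ((w @ [a]) ! i)) = (\<Prod>i<length w. step (take i w) (w ! i))"
    by (rule prod.cong) (auto simp: nth_append)
  then show ?thesis by (simp add: chain_def)
qed

lemma step_pos: "0 < step w a"
  by (simp add: step_def G_pos)

lemma chain_pos: "0 < chain w"
  by (simp add: chain_def prod_pos step_pos)

lemma recent_append: "k \<le> length v \<Longrightarrow> recent (u @ v) = recent v"
  by (simp add: recent_def)

lemma chain_short: "length w \<le> Suc k \<Longrightarrow> chain w = G w / G []"
proof (induction w rule: rev_induct)
  case (snoc a w)
  then have "chain (w @ [a]) = G w / G [] * step w a"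
    by (simp add: chain_snoc)
  moreover have "step w a = G (w @ [a]) / G w"
    using snoc.prems by (simp add: step_def recent_def)
  ultimately show ?case using G_pos[of w] by simp
qed (use G_pos[of "[]"] in \<open>simp add: chain_Nil\<close>)

lemma chain_right: "(\<lambda>a. chain (w @ [a])) sums chain w"
  using sums_mult[OF sums_divide[OF G_right[of "recent w"], of "G (recent w)"], of "chain w"] G_pos[of "recent w"]
  by (simp add: chain_snoc step_def)

lemma chain_left: "(\<lambda>b. chain (b # w)) sums chain w"
proof (induction w rule: rev_induct)
  case Nil
  show ?case using chain_right[of "[]"] by simp
next
  case (snoc a w)
  show ?case
  proof (cases "length w < k")
    case True
    then have "chain (b # w @ [a]) = G (b # w @ [a]) / G []" for b
      by (intro chain_short) simp
    then show ?thesis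
      using sums_divide[OF G_left[of "w @ [a]"], of "G []"] True by (simp add: chain_short)
  next
    case False
    then have "step (b # w) a = step w a" for b
      using recent_append[of w "[b]"] by (simp add: step_def)
    then have "chain (b # w @ [a]) = chain (b # w) * step w a" for b
      using chain_snoc[of "b # w" a] by simp
    then show ?thesis
      using sums_mult2[OF snoc, of "step w a"] by (simp add: chain_snoc)
  qed
qed

lemma chain_markov:
  assumes "length v = k"
  shows "chain (u @ v @ w) * chain v = chain (u @ v) * chain (v @ w)"
proof (induction w rule: rev_induct)
  case (snoc a w)
  have "step (u @ v @ w) a = step (v @ w) a"
    using recent_append[of "v @ w" u] assms by (simp add: step_def)
  then show ?case
    using snoc chain_snoc[of "u @ v @ w" a] chain_snoc[of "v @ w" a] by simp
qed simp

lemma kappa_ge_1: "1 \<le> \<kappa>"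
proof -
  have "0 < G ([] @ [0]) * G []" by (simp add: G_pos)
  then show ?thesis using G_ratio[of "[]" 0 "[]"] unfolding mult_le_cancel_right1 by blast
qed

lemma step_ratio: "step w a \<le> \<kappa> * step w' a"
  using G_ratio[of "recent w" a "recent w'"] G_pos[of "recent w"] G_pos[of "recent w'"]
  by (simp add: step_def divide_simps ac_simps)

text \<open>For \<open>v\<close> of length at most \<open>k\<close> one factor \<open>\<kappa>\<close> is lost for every letter. After \<open>k\<close> letters the chain
  no longer sees \<open>u\<close>, so longer words cost nothing more.\<close>

lemma chain_quasi_independent:
  "chain (u @ v) \<le> \<kappa> ^ k * chain u * chain v \<and> chain u * chain v \<le> \<kappa> ^ k * chain (u @ v)"
proof -
  have short: "chain (u @ v) \<le> \<kappa> ^ length v * (chain u * chain v) \<and>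
      chain u * chain v \<le> \<kappa> ^ length v * chain (u @ v)" for v
  proof (induction v rule: rev_induct)
    case (snoc a v)
    have "chain (u @ v) * step (u @ v) a \<le> \<kappa> ^ length v * (chain u * chain v) * (\<kappa> * step v a)"
    proof (rule mult_mono)
      show "0 \<le> \<kappa> ^ length v * (chain u * chain v)"
        using chain_pos[of u] chain_pos[of v] kappa_ge_1 by simp
    qed (use snoc step_ratio step_pos[of "u @ v" a] in simp_all)
    moreover have "chain u * chain v * step v a \<le> \<kappa> ^ length v * chain (u @ v) * (\<kappa> * step (u @ v) a)"
    proof (rule mult_mono)
      show "0 \<le> \<kappa> ^ length v * chain (u @ v)"
        using chain_pos[of "u @ v"] kappa_ge_1 by simp
    qed (use snoc step_ratio step_pos[of v a] in simp_all)
    ultimately show ?case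
      using chain_snoc[of "u @ v" a] chain_snoc[of v a] by (simp add: ac_simps)
  qed (simp add: chain_Nil)
  have pow: "\<kappa> ^ length v \<le> \<kappa> ^ k" if "length v \<le> k" for v :: "nat list"
    using kappa_ge_1 that by (rule power_increasing[rotated])
  have le_k: "chain (u @ v) \<le> \<kappa> ^ k * (chain u * chain v)" "chain u * chain v \<le> \<kappa> ^ k * chain (u @ v)"
    if "length v \<le> k" for v
  proof -
    have "0 \<le> chain u * chain v" "0 \<le> chain (u @ v)"
      using chain_pos[of u] chain_pos[of v] chain_pos[of "u @ v"] by auto
    then show "chain (u @ v) \<le> \<kappa> ^ k * (chain u * chain v)" "chain u * chain v \<le> \<kappa> ^ k * chain (u @ v)"
      using order_trans[OF conjunct1[OF short] mult_right_mono[OF pow[OF that]]]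
        order_trans[OF conjunct2[OF short] mult_right_mono[OF pow[OF that]]] by blast+
  qed
  show ?thesis
  proof (cases "length v \<le> k")
    case True
    then show ?thesis using le_k[of v] by (simp add: mult.assoc)
  next
    case False
    define v1 v2 where "v1 = take k v" and "v2 = drop k v"
    have v: "v = v1 @ v2" and len: "length v1 = k" using False by (auto simp: v1_def v2_def)
    have "chain (u @ v) * chain v1 = chain (u @ v1) * chain v"
      using chain_markov[OF len, of u v2] by (simp only: v)
    then have eq: "chain (u @ v) = chain (u @ v1) * (chain v / chain v1)"
      using chain_pos[of v1] by (simp add: field_simps)
    have c: "0 < chain v / chain v1"
      using chain_pos[of v] chain_pos[of v1] by simp
    have "chain (u @ v1) * (chain v / chain v1) \<le> \<kappa> ^ k * (chain u * chain v1) * (chain v / chain v1)"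
      "chain u * chain v1 * (chain v / chain v1) \<le> \<kappa> ^ k * chain (u @ v1) * (chain v / chain v1)"
      using le_k[of v1] len c by (auto intro!: mult_right_mono simp del: times_divide_eq_right)
    then show ?thesis
      using chain_pos[of v1] by (simp add: eq mult.assoc)
  qed
qed

sublocale markov_weights chain k "\<kappa> ^ k"
proof
  show "0 \<le> chain w" for w using chain_pos[of w] by simp
qed (rule chain_Nil chain_right k_pos chain_pos chain_left chain_markov
    chain_quasi_independent[THEN conjunct1] chain_quasi_independent[THEN conjunct2] | assumption)+

end

section \<open>Distortion along the chain\<close>

lemma invariant_weights_gauss: "0 < k \<Longrightarrow> invariant_weights gauss k 32"
  by unfold_locales (auto simp: gauss_pos gauss_right gauss_left gauss_ratio)

text \<open>The key estimate, valid for every word and not only for typical ones. Each transition of the chain exceeds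
  the true conditional Lebesgue probability at most by the distortion factor, and the cylinders of
  length \<open>k\<close> are no longer than \<open>1 / 2 ^ k\<close>. The first \<open>k\<close> letters, whose cylinders are not short,
  are treated separately: there the weight is a Gauss measure, whose density is bounded.\<close>

lemma chain_gauss_le:
  assumes k: "0 < k"
  shows "invariant_weights.chain gauss k w \<le> 2 * ((1 + 1 / 2 ^ k)\<^sup>2) ^ length w * cf_len w"
proof -
  interpret invariant_weights gauss k 32 using k by (rule invariant_weights_gauss)
  let ?\<rho> = "(1 + 1 / 2 ^ k :: real)\<^sup>2"
  have rho: "1 \<le> ?\<rho>" by (intro one_le_power) simp
  show ?thesis
  proof (induction w rule: rev_induct)
    case Nil
    then show ?case by (simp add: chain_Nil cf_len_def)
  next
    case (snoc a w)
    show ?case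
    proof (cases "length w < k")
      case True
      have "1 \<le> 2 * gauss []" using len_le_gauss[of "[]"] by (simp add: cf_len_def)
      then have "gauss (w @ [a]) / gauss [] \<le> 2 * gauss (w @ [a])"
        using gauss_pos[of "[]"] mult_right_mono[of 1 "2 * gauss []" "gauss (w @ [a])"] gauss_pos[of "w @ [a]"]
        by (simp add: divide_le_eq ac_simps)
      then have "chain (w @ [a]) \<le> 2 * cf_len (w @ [a])"
        using True gauss_le_len[of "w @ [a]"] by (simp add: chain_short)
      also have "\<dots> \<le> 2 * ?\<rho> ^ length (w @ [a]) * cf_len (w @ [a])"
        using one_le_power[OF rho, of "length (w @ [a])"] cf_len_pos[of "w @ [a]"]
        by (intro mult_right_mono) auto
      finally show ?thesis .
    next
      case False
      define u v where "u = take (length w - k) w" and "v = recent w"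
      have w: "w = u @ v" by (simp add: u_def v_def recent_def)
      have len: "length v = k" using False by (simp add: v_def recent_def)
      have "step w a * cf_len w = gauss (v @ [a]) * cf_len (u @ v) / gauss v"
        by (simp add: step_def v_def[symmetric] w[symmetric])
      also have "\<dots> \<le> (1 + cf_len v)\<^sup>2 * gauss v * cf_len (u @ v @ [a]) / gauss v"
        using gauss_distortion[of v a u] gauss_pos[of v] by (intro divide_right_mono) auto
      also have "\<dots> = (1 + cf_len v)\<^sup>2 * cf_len (w @ [a])"
        using gauss_pos[of v] by (simp add: w)
      also have "\<dots> \<le> ?\<rho> * cf_len (w @ [a])"
        using cf_len_le[of v] cf_len_pos[of v] cf_len_pos[of "w @ [a]"] len
        by (intro mult_right_mono power_mono) auto
      finally have s: "step w a * cf_len w \<le> ?\<rho> * cf_len (w @ [a])" .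
      have "chain (w @ [a]) = chain w * step w a" by (rule chain_snoc)
      also have "\<dots> \<le> 2 * ?\<rho> ^ length w * cf_len w * step w a"
        using snoc step_pos[of w a] by (intro mult_right_mono) auto
      also have "\<dots> = 2 * ?\<rho> ^ length w * (step w a * cf_len w)" by simp
      also have "\<dots> \<le> 2 * ?\<rho> ^ length w * (?\<rho> * cf_len (w @ [a]))"
        using s by (intro mult_left_mono) auto
      finally show ?thesis by (simp add: ac_simps)
    qed
  qed
qed

section \<open>Values of infinite continued fractions\<close>

definition cf_limit :: "(nat \<Rightarrow> nat) \<Rightarrow> real" where
  "cf_limit \<omega> = lim (\<lambda>n. cf_map (prefix_of n \<omega>) 0)"

lemma prefix_of_add: "prefix_of (m + n) \<omega> = prefix_of m \<omega> @ prefix_of n (shift_seq m \<omega>)"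
  by (auto simp: list_eq_iff_nth_eq nth_append shift_seq_def)

lemma prefix_of_Suc: "prefix_of (Suc n) \<omega> = \<omega> 0 # prefix_of n (shift_seq 1 \<omega>)"
  using prefix_of_add[of 1 n \<omega>] by (simp add: prefix_of_def)

lemma cf_convergent_eq:
  "(\<And>i. 1 \<le> i \<Longrightarrow> a i = Suc (\<omega> (i - 1))) \<Longrightarrow> cf_convergent n a = cf_map (prefix_of n \<omega>) 0"
proof (induction n arbitrary: a \<omega>)
  case (Suc n)
  have "cf_convergent n (\<lambda>i. a (Suc i)) = cf_map (prefix_of n (shift_seq 1 \<omega>)) 0"
    by (rule Suc.IH) (simp add: Suc.prems shift_seq_def)
  then show ?case using Suc.prems[of 1] by (simp add: prefix_of_Suc)
qed (simp add: prefix_of_def)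

lemma cf_prefix_bounds:
  "cf_lo (prefix_of m \<omega>) \<le> cf_map (prefix_of (m + n) \<omega>) 0"
  "cf_map (prefix_of (m + n) \<omega>) 0 \<le> cf_hi (prefix_of m \<omega>)"
  by (simp_all add: prefix_of_add cf_map_append cf_map_between cf_map_nonneg cf_map_le_1)

lemma cf_limit: "(\<lambda>n. cf_map (prefix_of n \<omega>) 0) \<longlonglongrightarrow> cf_limit \<omega>"
proof -
  let ?f = "\<lambda>n. cf_map (prefix_of n \<omega>) 0"
  have "Cauchy ?f"
  proof (rule metric_CauchyI)
    fix e :: real assume "0 < e"
    then obtain N where N: "(1 / 2) ^ N < e" using real_arch_pow_inv[of e "1/2"] by auto
    show "\<exists>M. \<forall>m\<ge>M. \<forall>n\<ge>M. dist (?f m) (?f n) < e"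
    proof (intro exI allI impI)
      fix m n assume "N \<le> m" "N \<le> n"
      then obtain m' n' where "m = N + m'" "n = N + n'" by (metis le_add_diff_inverse)
      then have "dist (?f m) (?f n) \<le> cf_len (prefix_of N \<omega>)"
        using cf_prefix_bounds[where m = N and n = m' and \<omega> = \<omega>] cf_prefix_bounds[where m = N and n = n' and \<omega> = \<omega>] cf_hi_minus_lo[of "prefix_of N \<omega>"]
        by (auto simp: dist_real_def)
      also have "\<dots> \<le> (1 / 2) ^ N"
        using cf_len_le[of "prefix_of N \<omega>"] by (simp add: power_one_over)
      finally show "dist (?f m) (?f n) < e" using N by simp
    qed
  qed
  then show ?thesis
    unfolding cf_limit_def by (simp add: Cauchy_convergent_iff convergent_LIMSEQ_iff)
qed

lemma cf_limit_bounds: "cf_lo (prefix_of m \<omega>) \<le> cf_limit \<omega>" "cf_limit \<omega> \<le> cf_hi (prefix_of m \<omega>)"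
proof -
  have "(\<lambda>n. cf_map (prefix_of (m + n) \<omega>) 0) \<longlonglongrightarrow> cf_limit \<omega>"
    using LIMSEQ_ignore_initial_segment[OF cf_limit[of \<omega>], of m] by (simp add: add.commute)
  then show "cf_lo (prefix_of m \<omega>) \<le> cf_limit \<omega>" "cf_limit \<omega> \<le> cf_hi (prefix_of m \<omega>)"
    using cf_prefix_bounds[where m = m and \<omega> = \<omega>] by (auto intro: LIMSEQ_le_const LIMSEQ_le_const2)
qed

lemma cf_limit_unfold: "cf_limit \<omega> = 1 / (1 + real (\<omega> 0) + cf_limit (shift_seq 1 \<omega>))"
  and cf_limit_nonneg: "0 \<le> cf_limit \<omega>"
proof -
  have nonneg: "0 \<le> cf_limit \<omega>" for \<omega>
    using cf_limit_bounds(1)[where m = 0 and \<omega> = \<omega>] by (simp add: prefix_of_def cf_lo_def)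
  show "0 \<le> cf_limit \<omega>" by (rule nonneg)
  have "(\<lambda>n. cf_map (prefix_of (Suc n) \<omega>) 0) \<longlonglongrightarrow> 1 / (1 + real (\<omega> 0) + cf_limit (shift_seq 1 \<omega>))"
    unfolding prefix_of_Suc cf_map.simps using nonneg[of "shift_seq 1 \<omega>"]
    by (intro tendsto_intros cf_limit) auto
  moreover have "(\<lambda>n. cf_map (prefix_of (Suc n) \<omega>) 0) \<longlonglongrightarrow> cf_limit \<omega>"
    by (rule LIMSEQ_Suc[OF cf_limit])
  ultimately show "cf_limit \<omega> = 1 / (1 + real (\<omega> 0) + cf_limit (shift_seq 1 \<omega>))"
    by (rule LIMSEQ_unique[rotated])
qed

lemma cf_limit_pos: "0 < cf_limit \<omega>"
  using cf_limit_nonneg[of "shift_seq 1 \<omega>"] by (subst cf_limit_unfold) simp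

lemma cf_limit_less_1: "cf_limit \<omega> < 1"
  using cf_limit_pos[of "shift_seq 1 \<omega>"] by (subst cf_limit_unfold) (simp add: divide_less_eq_1)

text \<open>Descent: if the value is \<open>p / q\<close>, then the value after deleting the first letter is a fraction with the
  denominator \<open>p < q\<close>.\<close>

lemma cf_limit_denominator: "0 < q \<Longrightarrow> cf_limit \<omega> * real q \<notin> \<int>"
proof (induction q arbitrary: \<omega> rule: less_induct)
  case (less q)
  show ?case
  proof
    assume "cf_limit \<omega> * real q \<in> \<int>"
    then obtain p where p: "cf_limit \<omega> * real q = of_int p" by (auto elim: Ints_cases)
    let ?x = "cf_limit (shift_seq 1 \<omega>)"
    have "0 < cf_limit \<omega> * real q" "cf_limit \<omega> * real q < 1 * real q"
      using cf_limit_pos[of \<omega>] cf_limit_less_1[of \<omega>] less.prems by (auto intro!: mult_strict_right_mono)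
    then have pq: "0 < p" "p < int q" unfolding p by simp_all
    have "0 < 1 + real (\<omega> 0) + ?x" using cf_limit_pos[of "shift_seq 1 \<omega>"] by simp
    then have "real q = of_int p * (1 + real (\<omega> 0) + ?x)"
      using p by (subst (asm) cf_limit_unfold) (simp add: field_simps)
    then have "?x * real (nat p) = of_int (int q - p * (1 + int (\<omega> 0)))"
      using pq by (simp add: algebra_simps)
    then have "?x * real (nat p) \<in> \<int>" by simp
    moreover have "nat p < q" "0 < nat p" using pq by auto
    ultimately show False using less.IH[of "nat p" "shift_seq 1 \<omega>"] by blast
  qed
qed

lemma cf_limit_irrational: "cf_limit \<omega> \<in> unit_irrationals"
proof -
  have "cf_limit \<omega> \<notin> \<rat>"
  proof
    assume "cf_limit \<omega> \<in> \<rat>"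
    then obtain a b :: int where "0 < b" "cf_limit \<omega> = of_int a / of_int b"
      by (rule Rats_cases') auto
    then have "cf_limit \<omega> * real (nat b) = of_int a" "0 < nat b" by auto
    then show False using cf_limit_denominator[of "nat b" \<omega>] by simp
  qed
  then show ?thesis
    using cf_limit_pos[of \<omega>] cf_limit_less_1[of \<omega>] by (simp add: unit_irrationals_def)
qed

lemma cf_value_digits: "cf_value (\<lambda>n. digit_process n \<omega>) = cf_limit \<omega>"
proof -
  have "cf_convergent n (\<lambda>n. digit_process n \<omega>) = cf_map (prefix_of n \<omega>) 0" for n
    by (rule cf_convergent_eq) (simp add: digit_process_def)
  then show ?thesis
    unfolding cf_value_def using cf_limit[of \<omega>] cf_limit_irrational[of \<omega>]
    by (auto intro!: the_equality intro: LIMSEQ_unique)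
qed

lemma measurable_prefix_of: "prefix_of n \<in> seq_space \<rightarrow>\<^sub>M count_space UNIV"
proof (subst measurable_count_space_eq2_countable, intro conjI ballI)
  fix w
  have "prefix_of n -` {w} \<inter> space seq_space = (if length w = n then cyl w else {})"
    by (auto simp: cyl_def)
  then show "prefix_of n -` {w} \<inter> space seq_space \<in> sets seq_space"
    by simp
qed auto

lemma measurable_cf_limit [measurable]: "cf_limit \<in> borel_measurable seq_space"
proof (rule borel_measurable_LIMSEQ_real[OF cf_limit])
  show "(\<lambda>\<omega>. cf_map (prefix_of n \<omega>) 0) \<in> borel_measurable seq_space" for n
    by (rule measurable_compose[OF measurable_prefix_of]) simp
qed

section \<open>Measure of intervals\<close>

lemma cf_interval_Cons:
  assumes "t \<in> {cf_lo (b # w)<..<cf_hi (b # w)}"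
  shows "1 / t - (1 + real b) \<in> {cf_lo w<..<cf_hi w}"
proof -
  have lh: "cf_lo w \<le> cf_hi w" by (simp add: cf_lo_def cf_hi_def)
  have lo: "cf_lo (b # w) = 1 / (1 + real b + cf_hi w)" and hi: "cf_hi (b # w) = 1 / (1 + real b + cf_lo w)"
  proof -
    have "1 / (1 + real b + t) \<le> 1 / (1 + real b + s)" if "0 \<le> s" "s \<le> t" for s t
      using that by (intro divide_left_mono) auto
    from this[of "cf_map w 0" "cf_map w 1"] this[of "cf_map w 1" "cf_map w 0"]
    show "cf_lo (b # w) = 1 / (1 + real b + cf_hi w)" "cf_hi (b # w) = 1 / (1 + real b + cf_lo w)"
      by (cases "cf_map w 0 \<le> cf_map w 1"; simp add: cf_lo_def cf_hi_def cf_map_nonneg)+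
  qed
  have "0 < cf_lo (b # w)" unfolding lo using cf_lo_nonneg[of w] lh by simp
  then have t: "0 < t" using assms by auto
  have "1 < t * (1 + real b + cf_hi w)" "t * (1 + real b + cf_lo w) < 1"
    using assms cf_lo_nonneg[of w] lh by (auto simp: lo hi divide_simps mult.commute)
  then have "1 / t < 1 + real b + cf_hi w" "1 + real b + cf_lo w < 1 / t"
    using t by (auto simp: divide_simps mult.commute)
  then show ?thesis by auto
qed

text \<open>A point determines its letters: the first one is given by the integer part of its reciprocal, and the
  remaining ones by the fractional part of that reciprocal.\<close>

lemma cf_interval_disjoint:
  assumes "length v = length w" "t \<in> {cf_lo v<..<cf_hi v}" "t \<in> {cf_lo w<..<cf_hi w}"
  shows "v = w"
  using assms
proof (induction v w arbitrary: t rule: list_induct2)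
  case (Cons b v c w)
  have 1: "1 / t - (1 + real b) \<in> {cf_lo v<..<cf_hi v}" "1 / t - (1 + real c) \<in> {cf_lo w<..<cf_hi w}"
    using Cons.prems by (auto dest!: cf_interval_Cons simp del: greaterThanLessThan_iff)
  have "real b < real c + 1" "real c < real b + 1"
    using 1 cf_lo_nonneg[of v] cf_lo_nonneg[of w] cf_hi_le_1[of v] cf_hi_le_1[of w] by auto
  then have "b = c" by linarith
  then show ?case using Cons.IH[OF 1(1)] 1(2) by simp
qed simp

text \<open>The cylinders of length \<open>n\<close> are disjoint, and those that meet \<open>[x, y]\<close> protrude from it by at most
  \<open>1 / 2 ^ n\<close> on either side. The unbounded digits do no harm because all cylinders of one common length are
  used, however small some of them are.\<close>

lemma sum_cf_len_meeting:
  assumes "x \<le> y"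
  shows "(\<integral>\<^sup>+w. cf_len w \<partial>count_space {w. length w = n \<and> {cf_lo w..cf_hi w} \<inter> {x..y} \<noteq> {}})
    \<le> ennreal (y - x + 2 / 2 ^ n)"
proof -
  let ?U = "{w. length w = n \<and> {cf_lo w..cf_hi w} \<inter> {x..y} \<noteq> {}}"
  let ?I = "\<lambda>w. {cf_lo w<..<cf_hi w}"
  have "(\<integral>\<^sup>+w. cf_len w \<partial>count_space ?U) = (\<integral>\<^sup>+w. emeasure lborel (?I w) \<partial>count_space ?U)"
    by (intro nn_integral_cong) (simp add: cf_hi_minus_lo[symmetric] cf_lo_def cf_hi_def)
  also have "\<dots> = emeasure lborel (\<Union>w\<in>?U. ?I w)"
  proof (rule emeasure_UN_countable[symmetric])
    show "disjoint_family_on ?I ?U"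
      unfolding disjoint_family_on_def using cf_interval_disjoint by blast
  qed simp_all
  also have "\<dots> \<le> emeasure lborel {x - 1 / 2 ^ n..y + 1 / 2 ^ n}"
  proof (rule emeasure_mono)
    show "(\<Union>w\<in>?U. ?I w) \<subseteq> {x - 1 / 2 ^ n..y + 1 / 2 ^ n}"
    proof (rule UN_least)
      fix w assume "w \<in> ?U"
      then obtain s where "length w = n" "s \<in> {cf_lo w..cf_hi w}" "s \<in> {x..y}" by blast
      then show "?I w \<subseteq> {x - 1 / 2 ^ n..y + 1 / 2 ^ n}"
        using cf_hi_minus_lo[of w] cf_len_le[of w] by auto
    qed
  qed simp
  also have "\<dots> = ennreal (y - x + 2 / 2 ^ n)"
  proof -
    have "0 \<le> 1 / (2 ^ n :: real)" by simp
    then have "x - 1 / 2 ^ n \<le> y + 1 / 2 ^ n" using assms by linarith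
    then show ?thesis by (subst emeasure_lborel_Icc) simp_all
  qed
  finally show ?thesis .
qed

lemma cf_limit_interval_bound:
  assumes M: "sets M = sets seq_space" and \<rho>: "0 \<le> \<rho>" and C: "0 \<le> C"
    and W: "\<And>w. emeasure M (cyl w) \<le> ennreal (C * \<rho> ^ length w * cf_len w)"
    and xy: "x \<le> y"
  shows "emeasure M {\<omega>. cf_limit \<omega> \<in> {x..y}} \<le> ennreal (C * \<rho> ^ n * (y - x + 2 / 2 ^ n))"
proof -
  let ?U = "{w. length w = n \<and> {cf_lo w..cf_hi w} \<inter> {x..y} \<noteq> {}}"
  have "{\<omega>. cf_limit \<omega> \<in> {x..y}} \<subseteq> {\<omega>. prefix_of n \<omega> \<in> ?U} \<inter> UNIV"
  proof
    fix \<omega> assume "\<omega> \<in> {\<omega>. cf_limit \<omega> \<in> {x..y}}"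
    then have "cf_limit \<omega> \<in> {cf_lo (prefix_of n \<omega>)..cf_hi (prefix_of n \<omega>)} \<inter> {x..y}"
      using cf_limit_bounds[where m = n and \<omega> = \<omega>] by simp
    then show "\<omega> \<in> {\<omega>. prefix_of n \<omega> \<in> ?U} \<inter> UNIV" by auto
  qed
  moreover have "{\<omega>. prefix_of n \<omega> \<in> ?U} \<inter> UNIV \<in> sets M"
    using measurable_sets[OF measurable_prefix_of, of ?U n] by (simp add: M vimage_def)
  ultimately have "emeasure M {\<omega>. cf_limit \<omega> \<in> {x..y}} \<le> emeasure M ({\<omega>. prefix_of n \<omega> \<in> ?U} \<inter> UNIV)"
    by (rule emeasure_mono)
  also have "\<dots> = (\<integral>\<^sup>+w. emeasure M (cyl w \<inter> UNIV) \<partial>count_space {w \<in> ?U. length w = n})"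
    by (rule emeasure_prefix_UN[OF M]) (use sets.top[of seq_space] in simp)
  also have "{w \<in> ?U. length w = n} = ?U" by auto
  also have "(\<integral>\<^sup>+w. emeasure M (cyl w \<inter> UNIV) \<partial>count_space ?U) \<le>
      (\<integral>\<^sup>+w. ennreal (C * \<rho> ^ n) * ennreal (cf_len w) \<partial>count_space ?U)"
    using W \<rho> C cf_len_pos by (intro nn_integral_mono) (auto simp: ennreal_mult[symmetric] less_imp_le)
  also have "\<dots> = ennreal (C * \<rho> ^ n) * (\<integral>\<^sup>+w. ennreal (cf_len w) \<partial>count_space ?U)"
    by (rule nn_integral_cmult) simp
  also have "\<dots> \<le> ennreal (C * \<rho> ^ n) * ennreal (y - x + 2 / 2 ^ n)"
    by (intro mult_left_mono sum_cf_len_meeting xy) simp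
  also have "\<dots> = ennreal (C * \<rho> ^ n * (y - x + 2 / 2 ^ n))"
    using \<rho> C xy by (simp add: ennreal_mult)
  finally show ?thesis .
qed

text \<open>For an interval of length \<open>r\<close>, cylinders of length \<open>n\<close> with \<open>1 / 2 ^ n\<close> of the order of \<open>r\<close> lose only
  a factor \<open>\<rho> ^ n \<le> (2 ^ n) powr d\<close>, which is of the order of \<open>r powr (- d)\<close>.\<close>

lemma cf_limit_frostman:
  assumes M: "sets M = sets seq_space" "prob_space M" and \<rho>: "0 \<le> \<rho>" "\<rho> \<le> 2 powr d" and C: "1 \<le> C"
    and W: "\<And>w. emeasure M (cyl w) \<le> ennreal (C * \<rho> ^ length w * cf_len w)"
    and d: "0 \<le> d" and s: "0 < s" "s \<le> 1 - d"
    and xy: "x \<le> y"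
  shows "emeasure M {\<omega>. cf_limit \<omega> \<in> {x..y}} \<le> ennreal (6 * C * (y - x) powr s)"
proof -
  interpret prob_space M by fact
  let ?A = "\<lambda>x y. {\<omega>. cf_limit \<omega> \<in> {x..y}}"
  have A: "?A x y \<in> sets M" for x y
    using measurable_sets[OF measurable_cf_limit, of "{x..y}"] by (simp add: M vimage_def)
  have pos: "prob (?A x y) \<le> 6 * C * (y - x) powr s" if xy: "x < y" for x y
  proof (cases "1 \<le> y - x")
    case True
    then have "1 \<le> (y - x) powr s" using s by (intro ge_one_powr_ge_zero) auto
    then have "1 * 1 \<le> 6 * C * (y - x) powr s" using C by (intro mult_mono) auto
    then show ?thesis using prob_le_1[of "?A x y"] by linarith
  next
    case False
    define r where "r = y - x"
    have r: "0 < r" "r < 1" using xy False by (auto simp: r_def)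
    define n where "n = (LEAST n. (1 / 2) ^ n \<le> r)"
    have ex: "\<exists>n. (1 / 2) ^ n \<le> r" using real_arch_pow_inv[OF r(1), of "1/2"] by (auto intro: less_imp_le)
    have n1: "(1 / 2) ^ n \<le> r" unfolding n_def by (rule LeastI_ex[OF ex])
    have "n \<noteq> 0" using n1 r by (intro notI) simp
    moreover have "\<not> (1 / 2) ^ (n - 1) \<le> r"
      using not_less_Least[of "n - 1" "\<lambda>n. (1 / 2) ^ n \<le> r"] \<open>n \<noteq> 0\<close> by (simp add: n_def)
    ultimately have n2: "r < 2 / 2 ^ n"
      by (cases n) (auto simp: power_one_over field_simps)
    have d1: "d \<le> 1" using s by simp
    have "\<rho> ^ n \<le> (2 powr d) ^ n" using \<rho> by (intro power_mono)
    also have "\<dots> = (2 ^ n) powr d"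
      by (simp add: powr_powr mult.commute flip: powr_realpow)
    also have "\<dots> \<le> (2 / r) powr d"
      using n2 r d by (intro powr_mono2) (auto simp: field_simps)
    also have "\<dots> = 2 powr d * r powr (- d)"
      using r by (simp add: powr_divide powr_minus_divide)
    also have "\<dots> \<le> 2 powr 1 * r powr (- d)"
      using d1 by (intro mult_right_mono powr_mono) auto
    finally have rho: "\<rho> ^ n \<le> 2 * r powr (- d)" by simp
    have "2 / 2 ^ n \<le> 2 * r" using n1 by (simp add: power_one_over)
    then have "r + 2 / 2 ^ n \<le> 3 * r" by simp
    then have "\<rho> ^ n * (r + 2 / 2 ^ n) \<le> 2 * r powr (- d) * (3 * r)"
      using rho \<rho> r by (intro mult_mono) auto
    also have "\<dots> = 6 * r powr (1 - d)"
      using r by (simp add: powr_diff powr_minus divide_inverse)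
    also have "\<dots> \<le> 6 * r powr s"
      using s r by (intro mult_left_mono powr_mono') auto
    finally have "C * (\<rho> ^ n * (r + 2 / 2 ^ n)) \<le> C * (6 * r powr s)"
      using C by (intro mult_left_mono) auto
    then have le: "C * \<rho> ^ n * (y - x + 2 / 2 ^ n) \<le> 6 * C * (y - x) powr s"
      by (simp add: r_def ac_simps)
    have "emeasure M (?A x y) \<le> ennreal (6 * C * (y - x) powr s)"
      using cf_limit_interval_bound[OF M(1) \<rho>(1) _ W, of x y n] C xy
      by (auto intro: order_trans ennreal_leI[OF le])
    then show ?thesis using C by (simp add: emeasure_eq_measure)
  qed
  have "prob (?A x y) \<le> 6 * C * (y - x) powr s"
  proof (cases "x < y")
    case False
    \<comment> \<open>A single point; as \<open>0 powr s = 0\<close>, the claim is that it has measure zero.\<close>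
    have lim: "(\<lambda>n. 6 * C * inverse (real (Suc n)) powr s) \<longlonglongrightarrow> 0"
      using s by (intro tendsto_mult_right_zero tendsto_zero_powrI[OF LIMSEQ_inverse_real_of_nat tendsto_const]) auto
    have "prob (?A x y) \<le> 6 * C * inverse (real (Suc n)) powr s" for n
    proof -
      have "prob (?A x y) \<le> prob (?A x (x + inverse (real (Suc n))))"
      proof (intro finite_measure_mono A)
        have "y \<le> x + inverse (real (Suc n))" using False by (simp add: add_increasing2)
        then show "?A x y \<subseteq> ?A x (x + inverse (real (Suc n)))" by auto
      qed
      also have "\<dots> \<le> 6 * C * inverse (real (Suc n)) powr s"
        using pos[of x "x + inverse (real (Suc n))"] by simp
      finally show ?thesis .
    qed
    then have "prob (?A x y) \<le> 0" by (intro LIMSEQ_le_const[OF lim]) auto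
    then show ?thesis using C by (simp add: order_trans)
  qed (use pos in auto)
  then show ?thesis
    by (simp add: emeasure_eq_measure ennreal_leI)
qed

section \<open>Dimension from interval bounds\<close>

lemma bounded_subset_interval:
  fixes U :: "real set"
  assumes "bounded U" "U \<noteq> {}"
  shows "U \<subseteq> {Inf U..Sup U}" "Sup U - Inf U \<le> diameter U" "Inf U \<le> Sup U"
proof -
  have bdd: "bdd_above U" "bdd_below U"
    using assms by (simp_all add: bounded_imp_bdd_above bounded_imp_bdd_below)
  show "U \<subseteq> {Inf U..Sup U}" using bdd by (auto intro: cSup_upper cInf_lower)
  have "u - v \<le> diameter U" if "u \<in> U" "v \<in> U" for u v
    using diameter_bounded_bound[OF assms(1) that] by (simp add: dist_real_def)
  then have "Sup U \<le> diameter U + v" if "v \<in> U" for v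
    using that assms by (intro cSup_least) (auto simp: algebra_simps)
  then have "Sup U - diameter U \<le> Inf U"
    using assms by (intro cInf_greatest) (auto simp: algebra_simps)
  then show "Sup U - Inf U \<le> diameter U" by simp
  show "Inf U \<le> Sup U" using assms bdd by (intro cInf_le_cSup)
qed

text \<open>The mass distribution principle. The sets of a cover need not be measurable; they are replaced by the
  intervals that they span, which have the same diameter.\<close>

lemma mass_distribution:
  fixes \<mu> :: "real measure"
  assumes sets: "sets \<mu> = sets borel" and s: "0 < s" and C: "0 < C"
    and intervals: "\<And>x y. x \<le> y \<Longrightarrow> emeasure \<mu> {x..y} \<le> ennreal (C * (y - x) powr s)"
    and E: "E \<in> sets borel" "emeasure \<mu> E = 1"
  shows "hausdorff_measure s E \<noteq> 0"
proof -
  have "ennreal (1 / C) \<le> hausdorff_pre_measure s 1 E"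
    unfolding hausdorff_pre_measure_def
  proof (rule INF_greatest, safe)
    fix U :: "nat \<Rightarrow> real set"
    assume cover: "E \<subseteq> (\<Union>i. U i)" and U: "\<forall>i. bounded (U i) \<and> diameter (U i) \<le> 1"
    define H where "H i = (if U i = {} then {} else {Inf (U i)..Sup (U i)})" for i
    have "E \<subseteq> (\<Union>i. H i)"
    proof
      fix x assume "x \<in> E"
      then obtain i where "x \<in> U i" using cover by blast
      moreover from this have "U i \<noteq> {}" by blast
      ultimately have "x \<in> H i" using bounded_subset_interval(1)[of "U i"] U unfolding H_def by auto
      then show "x \<in> (\<Union>i. H i)" by blast
    qed
    moreover have H: "H i \<in> sets \<mu>" for i by (simp add: H_def sets)
    ultimately have "1 \<le> emeasure \<mu> (\<Union>i. H i)"
      unfolding E(2)[symmetric] by (intro emeasure_mono) auto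
    also have "\<dots> \<le> (\<Sum>i. emeasure \<mu> (H i))"
      using H by (intro emeasure_subadditive_countably) auto
    also have "\<dots> \<le> (\<Sum>i. ennreal C * ennreal (diameter (U i) powr s))"
    proof (rule suminf_le)
      show "emeasure \<mu> (H i) \<le> ennreal C * ennreal (diameter (U i) powr s)" for i
      proof (cases "U i = {}")
        case False
        note b = bounded_subset_interval[OF _ False]
        have "emeasure \<mu> (H i) \<le> ennreal (C * (Sup (U i) - Inf (U i)) powr s)"
          using intervals[OF b(3)] U False by (simp add: H_def)
        also have "\<dots> \<le> ennreal (C * diameter (U i) powr s)"
          using b U C s by (intro ennreal_leI mult_left_mono powr_mono2) auto
        finally show ?thesis using C by (simp add: ennreal_mult)
      qed (simp add: H_def)
    qed simp_all
    also have "\<dots> = ennreal C * (\<Sum>i. ennreal (diameter (U i) powr s))"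
      by simp
    finally have "ennreal (1 / C) * 1 \<le> ennreal (1 / C) * (ennreal C * (\<Sum>i. ennreal (diameter (U i) powr s)))"
      by (intro mult_left_mono) auto
    also have "\<dots> = (\<Sum>i. ennreal (diameter (U i) powr s))"
      using C by (simp add: mult.assoc[symmetric] ennreal_mult[symmetric])
    finally show "ennreal (1 / C) \<le> (\<Sum>i. ennreal (diameter (U i) powr s))" by simp
  qed
  also have "\<dots> \<le> hausdorff_measure s E"
    unfolding hausdorff_measure_def by (rule SUP_upper) simp
  finally have "ennreal (1 / C) \<le> hausdorff_measure s E" .
  moreover have "0 < ennreal (1 / C)" using C by simp
  ultimately show ?thesis by (metis leD)
qed

lemma measure_dim_ge:
  assumes "\<And>E s. \<lbrakk>E \<subseteq> unit_irrationals; E \<in> sets borel; emeasure \<nu> E = 1; 0 < s; s \<le> t\<rbrakk>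
    \<Longrightarrow> hausdorff_measure s E \<noteq> 0"
  shows "ereal t \<le> measure_dim \<nu>"
  unfolding measure_dim_def hausdorff_dim_def
proof (intro INF_greatest)
  fix E s
  assume "E \<in> {E. E \<subseteq> unit_irrationals \<and> E \<in> sets borel \<and> emeasure \<nu> E = 1}"
    and "s \<in> {s. 0 < s \<and> hausdorff_measure s E = 0}"
  then have "\<not> s \<le> t" using assms[of E s] by auto
  then show "ereal t \<le> ereal s" by simp
qed

section \<open>The chain of memory \<open>k\<close>\<close>

lemma growth_rate: "(1 + 1 / 2 ^ k :: real)\<^sup>2 \<le> 2 powr (8 / 2 ^ k)"
proof -
  let ?x = "1 / 2 ^ k :: real"
  have "(1 + ?x)\<^sup>2 \<le> (exp ?x)\<^sup>2"
    by (intro power_mono exp_ge_add_one_self) simp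
  also have "\<dots> = exp 1 powr (2 * ?x)"
    by (simp add: powr_def exp_double[symmetric])
  also have "\<dots> \<le> (2 powr 2) powr (2 * ?x)"
    using exp_le by (intro powr_mono2) auto
  also have "\<dots> = 2 powr (4 * ?x)"
    unfolding powr_powr by simp
  also have "\<dots> \<le> 2 powr (8 * ?x)"
    by (intro powr_mono mult_right_mono) auto
  finally show ?thesis by simp
qed

theorem claim2p5:
  fixes k :: nat
  assumes "k \<ge> 3"
  shows "\<exists>(M :: (nat \<Rightarrow> nat) measure) (A :: nat \<Rightarrow> (nat \<Rightarrow> nat) \<Rightarrow> nat).
           prob_space M \<and> positive_nat_process M A \<and> markov_chain_step M k A \<and>
           stationary_process M A \<and> psi_mixing M A \<and>
           measure_dim (cf_distribution M A) \<ge> ereal (1 - 2 powi (3 - int k))"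
proof -
  have k: "0 < k" using assms by simp
  interpret invariant_weights gauss k 32 using k by (rule invariant_weights_gauss)
  let ?M = "law []"
  \<comment> \<open>Here \<open>?d\<close> is \<open>2 ^ (3 - k)\<close>, generous compared with the true loss.\<close>
  let ?\<rho> = "(1 + 1 / 2 ^ k :: real)\<^sup>2" and ?d = "8 / 2 ^ k :: real"
  have cyl_bound: "emeasure ?M (cyl w) \<le> ennreal (2 * ?\<rho> ^ length w * cf_len w)" for w
    using chain_gauss_le[OF k, of w] by (simp add: law_cyl ennreal_leI)
  have "(2::real) powi (3 - int k) = ?d"
    by (simp add: power_int_diff)
  then have d_eq: "1 - 2 powi (3 - int k) = 1 - ?d" by simp
  have cf: "cf_distribution ?M digit_process = distr ?M (restrict_space borel unit_irrationals) cf_limit"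
    by (simp add: cf_distribution_def cf_value_digits)
  have meas: "cf_limit \<in> ?M \<rightarrow>\<^sub>M borel"
    by (simp add: measurable_cong_sets[OF sets_law refl] measurable_cf_limit)
  then have meas_irr: "cf_limit \<in> ?M \<rightarrow>\<^sub>M restrict_space borel unit_irrationals"
    by (intro measurable_restrict_space2) (auto simp: cf_limit_irrational)
  have "ereal (1 - ?d) \<le> measure_dim (cf_distribution ?M digit_process)"
  proof (rule measure_dim_ge)
    fix E s
    assume E: "E \<subseteq> unit_irrationals" "E \<in> sets borel" "emeasure (cf_distribution ?M digit_process) E = 1"
      and s: "0 < s" "s \<le> 1 - ?d"
    have "E \<in> sets (restrict_space borel unit_irrationals)"
      using E by (auto simp: sets_restrict_space image_iff intro!: bexI[of _ E])
    then have one: "emeasure (distr ?M borel cf_limit) E = 1"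
      using E meas meas_irr by (simp add: cf emeasure_distr)
    show "hausdorff_measure s E \<noteq> 0"
    proof (rule mass_distribution[where \<mu> = "distr ?M borel cf_limit" and C = "6 * 2"])
      show "emeasure (distr ?M borel cf_limit) {x..y} \<le> ennreal (6 * 2 * (y - x) powr s)" if "x \<le> y" for x y
        using cf_limit_frostman[OF sets_law prob_space_law _ growth_rate[of k] _ cyl_bound _ s that] meas
        by (simp add: emeasure_distr vimage_def)
    qed (use E one s in auto)
  qed
  then show ?thesis
    unfolding d_eq
    using prob_space_law positive_digits markov_digits stationary_digits psi_mixing_digits by blast
qed

end
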